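(* Suppose $(\mathcal C,\mathcal D)$ is a regular MASA inclusion, with $\mathcal D$ an injective $C^*$-algebra. Then $(\mathcal C,\mathcal D)$ has the extension property; that is, every pure state of $\mathcal D$ has a unique extension to a state on $\mathcal C$, and no pure state of $\mathcal C$ annihilates $\mathcal D$.
   Context: All $C^*$-algebras are unital. An inclusion is a pair $(\mathcal C,\mathcal D)$ where $\mathcal C$ is a unital $C^*$-algebra and $\mathcal D\subseteq\mathcal C$ is an abelian $C^*$-subalgebra containing the unit of $\mathcal C$. Its normalizers are $\mathcal N(\mathcal C,\mathcal D)=\{v\in\mathcal C: v^*\mathcal Dv\cup v\mathcal Dv^*\subseteq\mathcal D\}$. The inclusion is regular if $\operatorname{span}\mathcal N(\mathcal C,\mathcal D)$ is norm dense in $\mathcal C$, and a MASA inclusion if $\mathcal D$ is a maximal abelian $C^*$-subalgebra of $\mathcal C$; a regular MASA inclusion is both. *)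

theory Defs
  imports "HOL-Analysis.Analysis" "HOL-Algebra.Module"
begin

section \<open>Unital C*-algebras as a type class\<close>

text \<open>The class \<open>real_normed_algebra_1\<close> contains \<open>0 \<noteq> 1\<close>, so C*-algebras are nonzero here.\<close>

class cstar_algebra = real_normed_algebra_1 + banach +
  fixes scaleC :: "complex \<Rightarrow> 'a \<Rightarrow> 'a" (infixr "*\<^sub>C" 75)
    and star :: "'a \<Rightarrow> 'a"
  assumes scaleC_add_right: "a *\<^sub>C (x + y) = a *\<^sub>C x + a *\<^sub>C y"
    and scaleC_add_left: "(a + b) *\<^sub>C x = a *\<^sub>C x + b *\<^sub>C x"
    and scaleC_scaleC: "a *\<^sub>C (b *\<^sub>C x) = (a * b) *\<^sub>C x"
    and scaleC_of_real: "complex_of_real r *\<^sub>C x = r *\<^sub>R x"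
    and mult_scaleC_left: "(a *\<^sub>C x) * y = a *\<^sub>C (x * y)"
    and mult_scaleC_right: "x * (a *\<^sub>C y) = a *\<^sub>C (x * y)"
    and norm_scaleC: "norm (a *\<^sub>C x) = cmod a * norm x"
    and star_star: "star (star x) = x"
    and star_add: "star (x + y) = star x + star y"
    and star_scaleC: "star (a *\<^sub>C x) = cnj a *\<^sub>C star x"
    and star_mult: "star (x * y) = star y * star x"
    and norm_star_mult: "norm (star x * x) = (norm x)\<^sup>2"

lemma scaleC_one: "1 *\<^sub>C x = (x :: 'a::cstar_algebra)"
  using scaleC_of_real[of 1 x] by simp

interpretation complex_vector: vector_space "scaleC :: complex \<Rightarrow> 'a::cstar_algebra \<Rightarrow> 'a"
  by unfold_locales (simp_all add: scaleC_add_right scaleC_add_left scaleC_scaleC scaleC_one)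


section \<open>Inclusions\<close>

definition cstar_subalgebra :: "'a::cstar_algebra set \<Rightarrow> bool" where
  "cstar_subalgebra A \<longleftrightarrow>
     0 \<in> A \<and> (\<forall>x\<in>A. \<forall>y\<in>A. x + y \<in> A) \<and> (\<forall>a. \<forall>x\<in>A. a *\<^sub>C x \<in> A) \<and>
     (\<forall>x\<in>A. \<forall>y\<in>A. x * y \<in> A) \<and> (\<forall>x\<in>A. star x \<in> A) \<and> closed A"

definition abelian_cstar_subalgebra :: "'a::cstar_algebra set \<Rightarrow> bool" where
  "abelian_cstar_subalgebra A \<longleftrightarrow> cstar_subalgebra A \<and> (\<forall>x\<in>A. \<forall>y\<in>A. x * y = y * x)"

text \<open>The ambient algebra \<open>\<C>\<close> of an inclusion \<open>(\<C>, \<D>)\<close> is the whole type.\<close>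

definition inclusion :: "'a::cstar_algebra set \<Rightarrow> bool" where
  "inclusion D \<longleftrightarrow> abelian_cstar_subalgebra D \<and> 1 \<in> D"

definition normalizers :: "'a::cstar_algebra set \<Rightarrow> 'a set" where
  "normalizers D = {v. (\<lambda>d. star v * d * v) ` D \<union> (\<lambda>d. v * d * star v) ` D \<subseteq> D}"

definition regular_inclusion :: "'a::cstar_algebra set \<Rightarrow> bool" where
  "regular_inclusion D \<longleftrightarrow> inclusion D \<and> closure (complex_vector.span (normalizers D)) = UNIV"

definition masa_inclusion :: "'a::cstar_algebra set \<Rightarrow> bool" where
  "masa_inclusion D \<longleftrightarrow> inclusion D \<and>
     (\<forall>A. abelian_cstar_subalgebra A \<and> D \<subseteq> A \<longrightarrow> A = D)"

definition regular_masa_inclusion :: "'a::cstar_algebra set \<Rightarrow> bool" where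
  "regular_masa_inclusion D \<longleftrightarrow> regular_inclusion D \<and> masa_inclusion D"


section \<open>States, pure states and the extension property\<close>

text \<open>Functionals on a subalgebra \<open>A\<close> are total functions of which only the values on \<open>A\<close>
  matter; in particular two of them are identified when they agree on \<open>A\<close>. Pure states are the
  extreme points of the state space.\<close>

definition state_on :: "'a::cstar_algebra set \<Rightarrow> ('a \<Rightarrow> complex) \<Rightarrow> bool" where
  "state_on A f \<longleftrightarrow>
     (\<forall>x\<in>A. \<forall>y\<in>A. f (x + y) = f x + f y) \<and> (\<forall>a. \<forall>x\<in>A. f (a *\<^sub>C x) = a * f x) \<and>
     (\<forall>x\<in>A. f (star x * x) \<in> \<real>\<^sub>\<ge>\<^sub>0) \<and> f 1 = 1"

definition pure_state_on :: "'a::cstar_algebra set \<Rightarrow> ('a \<Rightarrow> complex) \<Rightarrow> bool" where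
  "pure_state_on A f \<longleftrightarrow> state_on A f \<and>
     (\<forall>g h. \<forall>t::real. state_on A g \<and> state_on A h \<and> 0 < t \<and> t < 1 \<and>
        (\<forall>x\<in>A. f x = of_real t * g x + of_real (1 - t) * h x) \<longrightarrow>
        (\<forall>x\<in>A. g x = f x \<and> h x = f x))"

definition extension_property :: "'a::cstar_algebra set \<Rightarrow> bool" where
  "extension_property D \<longleftrightarrow>
     (\<forall>\<rho>. pure_state_on D \<rho> \<longrightarrow> (\<exists>!\<sigma>. state_on UNIV \<sigma> \<and> (\<forall>d\<in>D. \<sigma> d = \<rho> d))) \<and>
     \<not> (\<exists>\<sigma>. pure_state_on UNIV \<sigma> \<and> (\<forall>d\<in>D. \<sigma> d = 0))"


section \<open>Unital C*-algebras with explicit carriers\<close>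

text \<open>Injectivity quantifies over C*-algebras, which a type class cannot do inside a formula.\<close>

definition complex_ring :: "complex ring" where
  "complex_ring = \<lparr>carrier = UNIV, mult = (*), one = 1, zero = 0, add = (+)\<rparr>"

record 'u cstar_struct = "(complex, 'u) module" +
  adj :: "'u \<Rightarrow> 'u"
  nrm :: "'u \<Rightarrow> real"

locale unital_cstar_algebra = ring B + module complex_ring B for B (structure) +
  assumes one_neq_zero: "\<one> \<noteq> \<zero>"
    and smult_mult_left:
      "x \<in> carrier B \<Longrightarrow> y \<in> carrier B \<Longrightarrow> (a \<odot> x) \<otimes> y = a \<odot> (x \<otimes> y)"
    and smult_mult_right:
      "x \<in> carrier B \<Longrightarrow> y \<in> carrier B \<Longrightarrow> x \<otimes> (a \<odot> y) = a \<odot> (x \<otimes> y)"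
    and adj_closed: "x \<in> carrier B \<Longrightarrow> adj B x \<in> carrier B"
    and adj_adj: "x \<in> carrier B \<Longrightarrow> adj B (adj B x) = x"
    and adj_add:
      "x \<in> carrier B \<Longrightarrow> y \<in> carrier B \<Longrightarrow> adj B (x \<oplus> y) = adj B x \<oplus> adj B y"
    and adj_smult: "x \<in> carrier B \<Longrightarrow> adj B (a \<odot> x) = cnj a \<odot> adj B x"
    and adj_mult:
      "x \<in> carrier B \<Longrightarrow> y \<in> carrier B \<Longrightarrow> adj B (x \<otimes> y) = adj B y \<otimes> adj B x"
    and nrm_nonneg: "x \<in> carrier B \<Longrightarrow> 0 \<le> nrm B x"
    and nrm_eq_zero: "x \<in> carrier B \<Longrightarrow> nrm B x = 0 \<longleftrightarrow> x = \<zero>"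
    and nrm_add: "x \<in> carrier B \<Longrightarrow> y \<in> carrier B \<Longrightarrow> nrm B (x \<oplus> y) \<le> nrm B x + nrm B y"
    and nrm_smult: "x \<in> carrier B \<Longrightarrow> nrm B (a \<odot> x) = cmod a * nrm B x"
    and nrm_mult: "x \<in> carrier B \<Longrightarrow> y \<in> carrier B \<Longrightarrow> nrm B (x \<otimes> y) \<le> nrm B x * nrm B y"
    and nrm_adj_mult: "x \<in> carrier B \<Longrightarrow> nrm B (adj B x \<otimes> x) = (nrm B x)\<^sup>2"
    and complete:
      "(\<And>n. s n \<in> carrier B) \<Longrightarrow>
       (\<And>e. 0 < e \<Longrightarrow> \<exists>N. \<forall>m\<ge>N. \<forall>n\<ge>N. nrm B (s m \<ominus> s n) < e) \<Longrightarrow>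
       \<exists>l\<in>carrier B. (\<lambda>n::nat. nrm B (s n \<ominus> l)) \<longlonglongrightarrow> 0"

definition cstar_on :: "'a::cstar_algebra set \<Rightarrow> 'a cstar_struct" where
  "cstar_on A = \<lparr>carrier = A, mult = (*), one = 1, zero = 0, add = (+),
                 smult = scaleC, adj = star, nrm = norm\<rparr>"

lemma cring_complex_ring: "cring complex_ring"
proof (rule cringI)
  show "abelian_group complex_ring"
  proof (rule abelian_groupI)
    fix x :: complex
    assume "x \<in> carrier complex_ring"
    show "\<exists>y\<in>carrier complex_ring. y \<oplus>\<^bsub>complex_ring\<^esub> x = \<zero>\<^bsub>complex_ring\<^esub>"
      by (rule bexI[of _ "- x"]) (simp_all add: complex_ring_def)
  qed (simp_all add: complex_ring_def algebra_simps)
  show "comm_monoid complex_ring"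
    by unfold_locales (simp_all add: complex_ring_def algebra_simps)
qed (simp add: complex_ring_def algebra_simps)

lemma unital_cstar_algebra_cstar_on:
  fixes A :: "'a::cstar_algebra set"
  assumes A: "cstar_subalgebra A" and one: "1 \<in> A"
  shows "unital_cstar_algebra (cstar_on A)"
proof -
  note cl = A[unfolded cstar_subalgebra_def]
  have neg: "- x \<in> A" if "x \<in> A" for x
  proof -
    have "complex_of_real (-1) *\<^sub>C x \<in> A" using cl that by blast
    then show ?thesis by (simp only: scaleC_of_real) simp
  qed
  have ag: "abelian_group (cstar_on A)"
  proof (rule abelian_groupI)
    fix x
    assume "x \<in> carrier (cstar_on A)"
    then show "\<exists>y\<in>carrier (cstar_on A). y \<oplus>\<^bsub>cstar_on A\<^esub> x = \<zero>\<^bsub>cstar_on A\<^esub>"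
      using neg by (intro bexI[of _ "- x"]) (simp_all add: cstar_on_def)
  qed (use cl in \<open>simp_all add: cstar_on_def algebra_simps\<close>)
  have mon: "Group.monoid (cstar_on A)"
    by unfold_locales (use cl one in \<open>simp_all add: cstar_on_def algebra_simps\<close>)
  have ring: "ring (cstar_on A)"
    by (rule ringI[OF ag mon]) (simp_all add: cstar_on_def algebra_simps)
  have module: "module complex_ring (cstar_on A)"
    by (rule moduleI[OF cring_complex_ring ag])
      (use cl in \<open>simp_all add: cstar_on_def complex_ring_def scaleC_add_right scaleC_add_left
        scaleC_scaleC scaleC_one\<close>)
  interpret R: ring "cstar_on A" by (rule ring)
  have minus: "x \<ominus>\<^bsub>cstar_on A\<^esub> y = x - y" if "x \<in> A" "y \<in> A" for x y
  proof -
    have "\<ominus>\<^bsub>cstar_on A\<^esub> y = - y"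
      by (rule R.minus_equality) (use neg that in \<open>simp_all add: cstar_on_def\<close>)
    then show ?thesis by (simp add: a_minus_def cstar_on_def)
  qed
  have complete: "\<exists>l\<in>carrier (cstar_on A). (\<lambda>n. nrm (cstar_on A) (s n \<ominus>\<^bsub>cstar_on A\<^esub> l)) \<longlonglongrightarrow> 0"
    if s: "\<And>n::nat. s n \<in> carrier (cstar_on A)"
      and C: "\<And>e. 0 < e \<Longrightarrow>
        \<exists>N. \<forall>m\<ge>N. \<forall>n\<ge>N. nrm (cstar_on A) (s m \<ominus>\<^bsub>cstar_on A\<^esub> s n) < e" for s
  proof -
    have sA: "s n \<in> A" for n using s by (simp add: cstar_on_def)
    have "Cauchy s"
      unfolding Cauchy_def using C by (simp add: minus sA dist_norm) (simp add: cstar_on_def)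
    then obtain l where l: "s \<longlonglongrightarrow> l"
      using Cauchy_convergent convergentD by blast
    have lA: "l \<in> A"
      using closed_sequentially[of A s l] cl sA l by blast
    have "(\<lambda>n. norm (s n - l)) \<longlonglongrightarrow> 0"
      using l by (simp add: LIM_zero_iff tendsto_norm_zero_iff)
    then show ?thesis
      by (intro bexI[of _ l]) (use lA in \<open>simp_all add: minus sA\<close>, simp_all add: cstar_on_def)
  qed
  show ?thesis
    by (intro unital_cstar_algebra.intro ring module unital_cstar_algebra_axioms.intro)
      (use cl complete in \<open>simp_all add: cstar_on_def mult_scaleC_left mult_scaleC_right
        star_star star_add star_scaleC star_mult norm_triangle_ineq norm_scaleC norm_mult_ineq
        norm_star_mult\<close>)
qed


section \<open>Injectivity\<close>

definition operator_system :: "'u cstar_struct \<Rightarrow> 'u set \<Rightarrow> bool" where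
  "operator_system B S \<longleftrightarrow> S \<subseteq> carrier B \<and> \<one>\<^bsub>B\<^esub> \<in> S \<and>
     (\<forall>x\<in>S. \<forall>y\<in>S. x \<oplus>\<^bsub>B\<^esub> y \<in> S) \<and> (\<forall>a. \<forall>x\<in>S. a \<odot>\<^bsub>B\<^esub> x \<in> S) \<and> (\<forall>x\<in>S. adj B x \<in> S)"

text \<open>Positivity in \<open>M\<^sub>n(B)\<close>: the matrix is of the form \<open>Y\<^sup>* Y\<close> with \<open>Y \<in> M\<^sub>n(B)\<close>. Only the
  entries with indices below \<open>n\<close> count.\<close>

definition matrix_positive :: "'u cstar_struct \<Rightarrow> nat \<Rightarrow> (nat \<Rightarrow> nat \<Rightarrow> 'u) \<Rightarrow> bool" where
  "matrix_positive B n X \<longleftrightarrow>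
     (\<exists>Y. (\<forall>i<n. \<forall>j<n. Y i j \<in> carrier B) \<and>
          (\<forall>i<n. \<forall>j<n. X i j = (\<Oplus>\<^bsub>B\<^esub>k\<in>{..<n}. adj B (Y k i) \<otimes>\<^bsub>B\<^esub> Y k j)))"

definition completely_positive ::
  "'u cstar_struct \<Rightarrow> 'u set \<Rightarrow> 'v cstar_struct \<Rightarrow> ('u \<Rightarrow> 'v) \<Rightarrow> bool" where
  "completely_positive B S A \<phi> \<longleftrightarrow>
     (\<forall>x\<in>S. \<phi> x \<in> carrier A) \<and>
     (\<forall>x\<in>S. \<forall>y\<in>S. \<phi> (x \<oplus>\<^bsub>B\<^esub> y) = \<phi> x \<oplus>\<^bsub>A\<^esub> \<phi> y) \<and>
     (\<forall>a. \<forall>x\<in>S. \<phi> (a \<odot>\<^bsub>B\<^esub> x) = a \<odot>\<^bsub>A\<^esub> \<phi> x) \<and>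
     (\<forall>n X. (\<forall>i<n. \<forall>j<n. X i j \<in> S) \<and> matrix_positive B n X \<longrightarrow>
        matrix_positive A n (\<lambda>i j. \<phi> (X i j)))"

text \<open>Injectivity of \<open>A\<close> tested against the C*-algebras whose carrier is a subset of the
  type \<open>'u\<close>: every completely positive map into \<open>A\<close> from an operator system in such an algebra
  \<open>B\<close> extends to a completely positive map on \<open>B\<close>.\<close>

definition injective_in :: "'u itself \<Rightarrow> 'v cstar_struct \<Rightarrow> bool" where
  "injective_in U A \<longleftrightarrow>
     (\<forall>(B :: 'u cstar_struct) S \<phi>.
        unital_cstar_algebra B \<and> operator_system B S \<and> completely_positive B S A \<phi> \<longrightarrow>
        (\<exists>\<psi>. completely_positive B (carrier B) A \<psi> \<and> (\<forall>x\<in>S. \<psi> x = \<phi> x)))"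

text \<open>HOL formulas cannot quantify over types, so a universe for the test algebras has to be
  fixed. For an abelian subalgebra \<open>D\<close> of \<open>'a\<close> the type \<open>('a \<Rightarrow> complex) \<Rightarrow> complex\<close> is large
  enough: it carries all bounded functions on the pure state space \<open>X\<close> of \<open>D\<close> (represent pure states
  by functions of type \<open>'a \<Rightarrow> complex\<close> that vanish off \<open>D\<close>, and extend functions on \<open>X\<close> by \<open>0\<close>), an algebra \<open>\<ell>\<^sup>\<infinity>(X)\<close> that contains \<open>D\<close> by the Gelfand transform.
  Injectivity in this universe therefore gives a completely positive projection of \<open>\<ell>\<^sup>\<infinity>(X)\<close> onto
  \<open>D\<close>, and as \<open>\<ell>\<^sup>\<infinity>(X)\<close> is injective among all C*-algebras, so is \<open>D\<close>.\<close>

definition injective_abelian :: "'a::cstar_algebra set \<Rightarrow> bool" where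
  "injective_abelian D \<longleftrightarrow> injective_in TYPE(('a \<Rightarrow> complex) \<Rightarrow> complex) (cstar_on D)"

end

theory Submission
  imports Defs
begin

text \<open>Existence of extensions: injectivity gives a positive projection of \<open>\<C>\<close> onto \<open>\<D>\<close>.

  Uniqueness: let \<open>\<rho>\<close> be a pure state of \<open>\<D>\<close> and \<open>v\<close> a normalizer. If an extension of \<open>\<rho>\<close> does not
  vanish at \<open>v\<close>, then \<open>\<rho>\<close> is a fixed point of the partial homeomorphism induced by \<open>v\<close> on the
  spectrum of \<open>\<D>\<close>. Injectivity makes this spectrum extremally disconnected, algebraically: every
  subset of \<open>\<D>\<close> has a support projection. As in Frolik's theorem the fixed point set is then open,
  which yields \<open>k \<in> \<D>\<close> with \<open>\<rho>(k) \<noteq> 0\<close> such that \<open>k v k\<close> commutes with \<open>\<D>\<close>. Since \<open>\<D>\<close> is a MASA,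
  \<open>k v k \<in> \<D>\<close>, and every extension takes the value \<open>\<rho>(k v k) / \<rho>(k)\<^sup>2\<close> at \<open>v\<close>.

  Neither spectra nor characters are used: an element \<open>a\<close> counts as positive if it is self-adjoint
  and \<open>\<parallel>t - a\<parallel> \<le> t\<close> for some \<open>t\<close>, and square roots come from the binomial series.\<close>

text \<open>Injectivity is tested only on algebras inside one fixed type, and on completely positive
  maps; both facts shape the proof. The direct sum of two copies of \<C> is small enough as a test
  algebra, and one map P on it serves both purposes: x |-> P (x, x) is the projection, and P (0, 1)
  is the support of the chosen set. Complete positivity of the map to be extended must be verified,
  yet matrices over \<C> are never given a norm; positive matrices are factored by running the
  square root series entry by entry.

  Frolik's argument in terms of points: let U be a maximal open set that v moves off itself. Its
  closure is clopen by extremal disconnectedness and is still moved off itself. A point outside this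
  closure and its translates by v and \<open>star v\<close>, if moved by v, would have a
  neighbourhood that could be added to U; so v fixes what it does not kill there. A fixed point lies
  in none of the three sets, so some k that is nonzero at \<rho> vanishes on all of them.\<close>

lemma star_zero [simp]: "star (0::'a::cstar_algebra) = 0"
  using star_add[of "0::'a" 0] by simp

lemma star_minus: "star (- x) = - star (x::'a::cstar_algebra)"
  using star_add[of x "- x"] by (simp add: eq_neg_iff_add_eq_0 add.commute)

lemma star_diff: "star (x - y) = star x - star (y::'a::cstar_algebra)"
  by (simp only: diff_conv_add_uminus star_add star_minus)

lemma star_one [simp]: "star (1::'a::cstar_algebra) = 1"
  using star_mult[of "star (1::'a)" 1] by (simp add: star_star)

lemma star_scaleR: "star (r *\<^sub>R x) = r *\<^sub>R star (x::'a::cstar_algebra)"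
  using star_scaleC[of "complex_of_real r" x] by (simp add: scaleC_of_real)

lemma star_sum: "star (sum f S) = (\<Sum>i\<in>S. star (f i :: 'a::cstar_algebra))"
  by (induction S rule: infinite_finite_induct) (simp_all add: star_add)

lemma norm_star: "norm (star x) = norm (x::'a::cstar_algebra)"
proof -
  have le: "norm y \<le> norm (star y)" for y :: 'a
  proof (cases "norm y = 0")
    case False
    have "norm y * norm y \<le> norm (star y) * norm y"
      using norm_star_mult[of y] norm_mult_ineq[of "star y" y] by (simp add: power2_eq_square)
    then show ?thesis using False by (simp add: mult_right_le_imp_le)
  qed simp
  show ?thesis using le[of x] le[of "star x"] by (simp add: star_star)
qed

lemma bounded_linear_star: "bounded_linear (star :: 'a::cstar_algebra \<Rightarrow> 'a)"
  by (rule bounded_linear_intro[where K = 1]) (simp_all add: star_add star_scaleR norm_star)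

lemmas star_simps = star_add star_diff star_minus star_scaleR star_scaleC star_mult star_star

lemma bounded_linear_scaleC: "bounded_linear ((*\<^sub>C) c :: 'a::cstar_algebra \<Rightarrow> 'a)"
proof (rule bounded_linear_intro[where K = "cmod c"])
  fix r :: real and x :: 'a
  show "c *\<^sub>C r *\<^sub>R x = r *\<^sub>R c *\<^sub>C x"
    by (simp add: scaleC_of_real[symmetric] scaleC_scaleC mult.commute)
qed (simp_all add: scaleC_add_right norm_scaleC mult.commute)

lemma scaleC_uminus: "(- c) *\<^sub>C x = - (c *\<^sub>C (x::'a::cstar_algebra))"
  by simp

lemma scaleC_ii_ii: "\<i> *\<^sub>C \<i> *\<^sub>C x = - (x::'a::cstar_algebra)"
  by (simp add: scaleC_scaleC scaleC_one)

lemma eq_zero_of_star_mult: "star x * x = 0 \<Longrightarrow> x = (0::'a::cstar_algebra)"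
  using norm_star_mult[of x] by simp

lemma eq_zero_of_mult_star: "x * star x = 0 \<Longrightarrow> x = (0::'a::cstar_algebra)"
  using eq_zero_of_star_mult[of "star x"] norm_star[of x] by (simp add: star_star)

text \<open>The explicit formulas for \<open>h\<close> and \<open>k\<close> stay in the conclusion
  so that membership in a subalgebra and norm bounds can be read off from \<open>x\<close>.\<close>

lemma cartesian_decomposition:
  fixes x :: "'a::cstar_algebra"
  obtains h k where "star h = h" "star k = k" "x = h + \<i> *\<^sub>C k"
    "h = (1/2) *\<^sub>R (x + star x)" "k = (1/2) *\<^sub>R (\<i> *\<^sub>C (star x - x))"
proof
  show "star ((1/2) *\<^sub>R (x + star x)) = (1/2) *\<^sub>R (x + star x)"
    by (simp add: star_simps add.commute)
  show "star ((1/2) *\<^sub>R (\<i> *\<^sub>C (star x - x))) = (1/2) *\<^sub>R (\<i> *\<^sub>C (star x - x))"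
    by (simp add: star_simps complex_vector.scale_right_diff_distrib)
  have "\<i> *\<^sub>C (1/2) *\<^sub>R (\<i> *\<^sub>C (star x - x)) = (1/2) *\<^sub>R \<i> *\<^sub>C \<i> *\<^sub>C (star x - x)"
    by (rule linear_scale[OF bounded_linear.linear[OF bounded_linear_scaleC]])
  also have "\<dots> = (1/2) *\<^sub>R (x - star x)" by (simp only: scaleC_ii_ii) simp
  finally show "x = (1/2) *\<^sub>R (x + star x) + \<i> *\<^sub>C (1/2) *\<^sub>R (\<i> *\<^sub>C (star x - x))"
    by (simp add: scaleR_add_right[symmetric] scaleR_2[symmetric])
qed (rule refl)+

section \<open>Unital subalgebras\<close>

locale unital_subalgebra =
  fixes A :: "'a::cstar_algebra set"
  assumes subalgebra: "cstar_subalgebra A" and one_mem [simp, intro]: "1 \<in> A"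
begin

lemma zero_mem [simp, intro]: "0 \<in> A"
  and add_mem [intro]: "x \<in> A \<Longrightarrow> y \<in> A \<Longrightarrow> x + y \<in> A"
  and mult_mem [intro]: "x \<in> A \<Longrightarrow> y \<in> A \<Longrightarrow> x * y \<in> A"
  and star_mem [intro]: "x \<in> A \<Longrightarrow> star x \<in> A"
  and scaleC_mem [intro]: "x \<in> A \<Longrightarrow> c *\<^sub>C x \<in> A"
  and closed: "closed A"
  using subalgebra by (auto simp: cstar_subalgebra_def)

lemma scaleR_mem [intro]: "x \<in> A \<Longrightarrow> r *\<^sub>R x \<in> A"
  using scaleC_mem[of x "complex_of_real r"] by (simp add: scaleC_of_real)

lemma minus_mem [intro]: "x \<in> A \<Longrightarrow> - x \<in> A"
  using scaleR_mem[of x "-1"] by simp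

lemma diff_mem [intro]: "x \<in> A \<Longrightarrow> y \<in> A \<Longrightarrow> x - y \<in> A"
  using add_mem[of x "- y"] by auto

lemma sum_mem [intro]: "(\<And>i. i \<in> S \<Longrightarrow> f i \<in> A) \<Longrightarrow> sum f S \<in> A"
  by (induction S rule: infinite_finite_induct) auto

lemma power_mem [intro]: "x \<in> A \<Longrightarrow> x ^ n \<in> A"
  by (induction n) auto

lemma suminf_mem:
  assumes "\<And>i. f i \<in> A" "summable f"
  shows "suminf f \<in> A"
  using closed_sequentially[OF closed, of "\<lambda>n. \<Sum>i<n. f i"] summable_LIMSEQ[OF assms(2)] assms(1)
  by auto

end

locale abelian_subalgebra = unital_subalgebra A for A :: "'a::cstar_algebra set" +
  assumes commute: "x \<in> A \<Longrightarrow> y \<in> A \<Longrightarrow> x * y = y * x"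

lemma inclusion_iff: "inclusion D \<longleftrightarrow> abelian_subalgebra D"
  by (auto simp: inclusion_def abelian_cstar_subalgebra_def abelian_subalgebra_def
      abelian_subalgebra_axioms_def unital_subalgebra_def)

section \<open>Commutants and maximal abelian subalgebras\<close>

definition commutant :: "'a::cstar_algebra set \<Rightarrow> 'a set" where
  "commutant S = {x. \<forall>y\<in>S. x * y = y * x}"

lemma unital_subalgebra_commutant:
  assumes "\<And>y. y \<in> S \<Longrightarrow> star y \<in> S"
  shows "unital_subalgebra (commutant S)"
proof -
  have "closed (\<Inter>y\<in>S. {x. x * y = y * x})"
    by (intro closed_INT ballI closed_Collect_eq continuous_intros)
  moreover have "commutant S = (\<Inter>y\<in>S. {x. x * y = y * x})"
    by (auto simp: commutant_def)
  ultimately have "closed (commutant S)" by simp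
  moreover have "star x \<in> commutant S" if "x \<in> commutant S" for x
  proof -
    have "star x * y = y * star x" if "y \<in> S" for y
    proof -
      have "x * star y = star y * x" using assms that \<open>x \<in> commutant S\<close> by (auto simp: commutant_def)
      then have "star (x * star y) = star (star y * x)" by simp
      then show ?thesis by (simp add: star_simps)
    qed
    then show ?thesis by (simp add: commutant_def)
  qed
  moreover have "x * y \<in> commutant S" if "x \<in> commutant S" "y \<in> commutant S" for x y
  proof -
    have "x * y * z = z * (x * y)" if "z \<in> S" for z
    proof -
      have "x * z = z * x" "y * z = z * y"
        using \<open>x \<in> commutant S\<close> \<open>y \<in> commutant S\<close> that by (auto simp: commutant_def)
      then show ?thesis by (metis mult.assoc)
    qed
    then show ?thesis by (simp add: commutant_def)
  qed
  moreover have "x + y \<in> commutant S" if "x \<in> commutant S" "y \<in> commutant S" for x y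
    using that by (simp add: commutant_def algebra_simps)
  moreover have "c *\<^sub>C x \<in> commutant S" if "x \<in> commutant S" for c x
    using that by (simp add: commutant_def mult_scaleC_left mult_scaleC_right)
  moreover have "0 \<in> commutant S" "1 \<in> commutant S"
    by (simp_all add: commutant_def)
  ultimately show ?thesis
    unfolding unital_subalgebra_def cstar_subalgebra_def by (intro conjI ballI allI)
qed

text \<open>The bicommutant stands in for the generated C*-algebra, with closedness for free. As
  \<open>S\<close> lies in its commutant, the bicommutant lies in the commutant too and therefore
  commutes with itself.\<close>

lemma abelian_bicommutant:
  assumes "\<And>x. x \<in> S \<Longrightarrow> star x \<in> S" "\<And>x y. x \<in> S \<Longrightarrow> y \<in> S \<Longrightarrow> x * y = y * x"
  shows "abelian_subalgebra (commutant (commutant S))" "S \<subseteq> commutant (commutant S)"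
proof -
  interpret c: unital_subalgebra "commutant S"
    using assms(1) by (rule unital_subalgebra_commutant)
  interpret cc: unital_subalgebra "commutant (commutant S)"
    using c.star_mem by (rule unital_subalgebra_commutant)
  show sub: "S \<subseteq> commutant (commutant S)"
    by (auto simp: commutant_def)
  have "S \<subseteq> commutant S" using assms(2) by (auto simp: commutant_def)
  then have "commutant (commutant S) \<subseteq> commutant S" by (auto simp: commutant_def)
  then show "abelian_subalgebra (commutant (commutant S))"
    by unfold_locales (auto simp: commutant_def[of "commutant S"])
qed

text \<open>The last conclusion lets in inverses of elements built from \<open>h\<close>, since they
  commute with everything that \<open>h\<close> commutes with.\<close>

lemma abelian_subalgebra_containing:
  fixes h :: "'a::cstar_algebra"
  assumes "star h = h"
  obtains A where "abelian_subalgebra A" "h \<in> A"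
    "\<And>x. (\<And>y. h * y = y * h \<Longrightarrow> x * y = y * x) \<Longrightarrow> x \<in> A"
proof (rule that)
  show "abelian_subalgebra (commutant (commutant {h}))" "h \<in> commutant (commutant {h})"
    using abelian_bicommutant[of "{h}"] assms by auto
qed (auto simp: commutant_def)

text \<open>For self-adjoint \<open>h\<close> the bicommutant of \<open>D\<close> with
  \<open>h\<close> adjoined is an abelian subalgebra containing \<open>D\<close>, so maximality
  applies. Self-adjointness keeps the generating set closed under \<open>star\<close>.\<close>

lemma masa_commutant:
  assumes "masa_inclusion D" "x \<in> commutant D"
  shows "x \<in> D"
proof -
  interpret abelian_subalgebra D
    using assms(1) by (simp add: masa_inclusion_def inclusion_iff)
  interpret c: unital_subalgebra "commutant D"
    by (rule unital_subalgebra_commutant) auto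
  have sa: "h \<in> D" if "star h = h" "h \<in> commutant D" for h
  proof -
    let ?A = "commutant (commutant (insert h D))"
    have "abelian_subalgebra ?A" "insert h D \<subseteq> ?A"
      using that star_mem commute by (intro abelian_bicommutant; auto simp: commutant_def)+
    moreover from this have "?A = D"
      using assms(1) unfolding masa_inclusion_def inclusion_iff[symmetric] inclusion_def by auto
    ultimately show ?thesis by auto
  qed
  obtain h k where hk: "star h = h" "star k = k" "x = h + \<i> *\<^sub>C k"
    "h = (1/2) *\<^sub>R (x + star x)" "k = (1/2) *\<^sub>R (\<i> *\<^sub>C (star x - x))"
    by (rule cartesian_decomposition)
  have "h \<in> commutant D" "k \<in> commutant D"
    unfolding hk(4,5) using assms(2) by blast+
  then show ?thesis using sa hk(1,2) unfolding hk(3) by blast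
qed

section \<open>Square roots by the binomial series\<close>

text \<open>The Taylor coefficients of sqrt (1 - x) at 0.\<close>

definition sqrt_coeff :: "nat \<Rightarrow> real" where
  "sqrt_coeff k = (-1) ^ k * ((1/2) gchoose k)"

lemma sqrt_coeff_0: "sqrt_coeff 0 = 1"
  by (simp add: sqrt_coeff_def)

lemma sqrt_coeff_Suc: "sqrt_coeff (Suc k) = sqrt_coeff k * ((real k - 1/2) / real (Suc k))"
proof -
  have "((1/2::real) gchoose Suc k) = (1/2 gchoose k) * ((1/2 - real k) / real (Suc k))"
    using gbinomial_mult_1[of "1/2::real" k] by (simp add: field_simps)
  then have "sqrt_coeff (Suc k) = (-1) ^ Suc k * ((1/2 gchoose k) * ((1/2 - real k) / real (Suc k)))"
    by (simp only: sqrt_coeff_def)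
  also have "\<dots> = sqrt_coeff k * (- ((1/2 - real k) / real (Suc k)))"
    by (simp add: sqrt_coeff_def del: of_nat_Suc)
  finally show ?thesis by (simp add: minus_divide_left del: of_nat_Suc)
qed

lemma sqrt_coeff_Suc_nonpos: "sqrt_coeff (Suc k) \<le> 0"
proof (induction k)
  case (Suc k)
  then show ?case
    unfolding sqrt_coeff_Suc[of "Suc k"] by (intro mult_nonpos_nonneg) auto
qed (simp add: sqrt_coeff_Suc sqrt_coeff_0)

text \<open>Dividing sqrt (1 - x) by 1 - x turns coefficients into partial sums, and (1 - x) to the
  power -1/2 has positive coefficients.\<close>

lemma sqrt_coeff_partial_sum_nonneg: "0 \<le> (\<Sum>k\<le>n. sqrt_coeff k)"
proof -
  have "(\<Sum>k\<le>n. sqrt_coeff k) = (-1) ^ n * ((- (1/2)) gchoose n)"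
    using gbinomial_sum_lower_neg[of "1/2::real" n] by (simp add: sqrt_coeff_def mult.commute)
  also have "\<dots> = ((real n - 1/2) gchoose n)"
    by (simp add: gbinomial_minus[of "1/2"] algebra_simps flip: power_mult_distrib)
  also have "0 \<le> \<dots>"
    unfolding gbinomial_prod_rev by (intro divide_nonneg_pos prod_nonneg) auto
  finally show ?thesis .
qed

text \<open>The first coefficient is 1, the others are nonpositive, and the partial sums stay
  nonnegative; so the absolute values of the others cannot add up to more than 1.\<close>

lemma summable_sqrt_coeff: "summable (\<lambda>k. \<bar>sqrt_coeff k\<bar>)"
  and sqrt_coeff_tail_le: "(\<Sum>k. \<bar>sqrt_coeff (Suc k)\<bar>) \<le> 1"
proof -
  have bound: "(\<Sum>k<n. \<bar>sqrt_coeff (Suc k)\<bar>) \<le> 1" for n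
  proof -
    have "(\<Sum>k<n. \<bar>sqrt_coeff (Suc k)\<bar>) = - (\<Sum>k<n. sqrt_coeff (Suc k))"
      using sqrt_coeff_Suc_nonpos by (simp add: abs_of_nonpos sum_negf)
    moreover have "(\<Sum>k\<le>n. sqrt_coeff k) = 1 + (\<Sum>k<n. sqrt_coeff (Suc k))"
      by (simp add: lessThan_Suc_atMost[symmetric] sum.lessThan_Suc_shift sqrt_coeff_0
          del: sum.lessThan_Suc)
    ultimately show ?thesis using sqrt_coeff_partial_sum_nonneg[of n] by linarith
  qed
  have s: "summable (\<lambda>k. \<bar>sqrt_coeff (Suc k)\<bar>)"
    by (rule bounded_imp_summable[of _ 1]) (use bound[of "Suc _"] in \<open>simp_all only: lessThan_Suc_atMost abs_ge_zero\<close>)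
  then show "summable (\<lambda>k. \<bar>sqrt_coeff k\<bar>)"
    by (subst (asm) summable_Suc_iff)
  show "(\<Sum>k. \<bar>sqrt_coeff (Suc k)\<bar>) \<le> 1"
    by (rule suminf_le_const[OF s bound])
qed

text \<open>Vandermonde for 1/2 + 1/2 = 1: the formal square of sqrt (1 - x) is 1 - x.\<close>

lemma sqrt_coeff_convolution:
  "(\<Sum>i\<le>n. sqrt_coeff i * sqrt_coeff (n - i)) = (if n = 0 then 1 else if n = 1 then -1 else 0)"
proof -
  have "(\<Sum>i\<le>n. sqrt_coeff i * sqrt_coeff (n - i))
      = (\<Sum>i\<le>n. (-1) ^ n * ((1/2 gchoose i) * (1/2 gchoose (n - i))))"
    by (intro sum.cong) (auto simp: sqrt_coeff_def power_add[symmetric])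
  also have "\<dots> = (-1) ^ n * (1 gchoose n)"
    using gbinomial_Vandermonde[of "1/2::real" "1/2" n]
    by (simp add: sum_distrib_left[symmetric] atMost_atLeast0)
  also have "\<dots> = (if n = 0 then 1 else if n = 1 then -1 else 0)"
    using binomial_gbinomial[of 1 n, where 'a = real] by (auto simp: binomial_eq_0)
  finally show ?thesis .
qed

text \<open>The case \<open>n = 1\<close> is the square root of \<open>1 - x\<close> for an element \<open>x\<close> of norm at most 1; for
  matrices \<open>M k\<close> are the powers of a contraction, of which only the entries are normed.\<close>

lemma sqrt_series:
  fixes M :: "nat \<Rightarrow> nat \<Rightarrow> nat \<Rightarrow> 'a::{real_normed_algebra_1,banach}"
  assumes mult: "\<And>a b i j. i < n \<Longrightarrow> j < n \<Longrightarrow> M (a + b) i j = (\<Sum>l<n. M a i l * M b l j)"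
    and norm: "\<And>k i j. i < n \<Longrightarrow> j < n \<Longrightarrow> norm (M k i j) \<le> 1"
    and Z: "\<And>i j. Z i j = (\<Sum>k. sqrt_coeff k *\<^sub>R M k i j)"
  shows "\<And>i j. i < n \<Longrightarrow> j < n \<Longrightarrow> summable (\<lambda>k. norm (sqrt_coeff k *\<^sub>R M k i j))"
    and "\<And>i j. i < n \<Longrightarrow> j < n \<Longrightarrow> (\<Sum>l<n. Z i l * Z l j) = M 0 i j - M 1 i j"
proof -
  show sn: "summable (\<lambda>k. norm (sqrt_coeff k *\<^sub>R M k i j))" if "i < n" "j < n" for i j
    by (rule summable_comparison_test'[OF summable_sqrt_coeff])
      (use norm[OF that] in \<open>simp add: mult_left_le\<close>)
  fix i j assume ij: "i < n" "j < n"
  let ?g = "\<lambda>l k. \<Sum>p\<le>k. (sqrt_coeff p *\<^sub>R M p i l) * (sqrt_coeff (k - p) *\<^sub>R M (k - p) l j)"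
  have "?g l sums (Z i l * Z l j)" if "l < n" for l
    unfolding Z using sn ij that by (intro Cauchy_product_sums) auto
  then have "(\<lambda>k. \<Sum>l<n. ?g l k) sums (\<Sum>l<n. Z i l * Z l j)"
    by (intro sums_sum) auto
  moreover have "(\<Sum>l<n. ?g l k) = (\<Sum>p\<le>k. sqrt_coeff p * sqrt_coeff (k - p)) *\<^sub>R M k i j" for k
  proof -
    have "(\<Sum>l<n. ?g l k)
        = (\<Sum>p\<le>k. (sqrt_coeff p * sqrt_coeff (k - p)) *\<^sub>R (\<Sum>l<n. M p i l * M (k - p) l j))"
      by (subst sum.swap) (simp add: scaleR_sum_right mult.commute)
    also have "\<dots> = (\<Sum>p\<le>k. (sqrt_coeff p * sqrt_coeff (k - p)) *\<^sub>R M k i j)"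
    proof (intro sum.cong refl)
      fix p assume "p \<in> {..k}"
      then show "(sqrt_coeff p * sqrt_coeff (k - p)) *\<^sub>R (\<Sum>l<n. M p i l * M (k - p) l j)
          = (sqrt_coeff p * sqrt_coeff (k - p)) *\<^sub>R M k i j"
        using mult[OF ij, of p "k - p"] by simp
    qed
    finally show ?thesis by (simp add: scaleR_sum_left)
  qed
  moreover have "(\<lambda>k. (\<Sum>p\<le>k. sqrt_coeff p * sqrt_coeff (k - p)) *\<^sub>R M k i j)
      sums (\<Sum>k\<in>{0, 1}. (\<Sum>p\<le>k. sqrt_coeff p * sqrt_coeff (k - p)) *\<^sub>R M k i j)"
    by (rule sums_finite) (auto simp: sqrt_coeff_convolution)
  ultimately have "(\<Sum>l<n. Z i l * Z l j)
      = (\<Sum>k\<in>{0, 1}. (\<Sum>p\<le>k. sqrt_coeff p * sqrt_coeff (k - p)) *\<^sub>R M k i j)"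
    by (simp add: sums_unique2)
  then show "(\<Sum>l<n. Z i l * Z l j) = M 0 i j - M 1 i j"
    by (simp add: sqrt_coeff_convolution del: sum.atMost_Suc)
qed

section \<open>The positive cone\<close>

text \<open>For self-adjoint \<open>a\<close> the inequality says that the spectrum lies in [0, 2t].
  In this form closure under sums is the triangle inequality.\<close>

definition pos :: "'a::cstar_algebra \<Rightarrow> bool" where
  "pos a \<longleftrightarrow> star a = a \<and> (\<exists>t. norm (t *\<^sub>R 1 - a) \<le> t)"

lemma pos_star: "pos a \<Longrightarrow> star a = a"
  by (simp add: pos_def)

lemma pos_add: "pos a \<Longrightarrow> pos b \<Longrightarrow> pos (a + b)"
proof -
  assume "pos a" "pos b"
  then obtain t u where "star a = a" "star b = b" "norm (t *\<^sub>R 1 - a) \<le> t" "norm (u *\<^sub>R 1 - b) \<le> u"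
    by (auto simp: pos_def)
  moreover have "(t + u) *\<^sub>R 1 - (a + b) = (t *\<^sub>R 1 - a) + (u *\<^sub>R 1 - b)"
    by (simp add: algebra_simps)
  ultimately have "norm ((t + u) *\<^sub>R 1 - (a + b)) \<le> t + u"
    by (metis add_mono norm_triangle_le)
  then show ?thesis using \<open>star a = a\<close> \<open>star b = b\<close> by (auto simp: pos_def star_add)
qed

lemma pos_scaleR:
  assumes "pos a" "0 \<le> r"
  shows "pos (r *\<^sub>R a)"
proof -
  obtain t where t: "norm (t *\<^sub>R 1 - a) \<le> t" using assms(1) unfolding pos_def by blast
  have "(r * t) *\<^sub>R 1 - r *\<^sub>R a = r *\<^sub>R (t *\<^sub>R 1 - a)" by (simp add: algebra_simps)
  then have "norm ((r * t) *\<^sub>R 1 - r *\<^sub>R a) \<le> r * t"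
    using t assms(2) by (simp add: mult_left_mono)
  then show ?thesis using assms(1) by (auto simp: pos_def star_scaleR)
qed

lemma pos_of_real: "0 \<le> r \<Longrightarrow> pos (r *\<^sub>R 1)"
  unfolding pos_def by (auto simp: star_scaleR intro!: exI[of _ r])

lemma pos_zero [simp]: "pos 0" and pos_one [simp]: "pos 1"
  using pos_of_real[of 0] pos_of_real[of 1] by simp_all

lemma pos_sum: "(\<And>i. i \<in> S \<Longrightarrow> pos (f i)) \<Longrightarrow> pos (sum f S)"
  by (induction S rule: infinite_finite_induct) (auto intro: pos_add)

lemma of_real_pos_nonneg: "pos (r *\<^sub>R (1::'a::cstar_algebra)) \<Longrightarrow> 0 \<le> r"
proof -
  assume "pos (r *\<^sub>R (1::'a))"
  then obtain t where "norm ((t - r) *\<^sub>R (1::'a)) \<le> t" by (auto simp: pos_def algebra_simps)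
  then show ?thesis by simp
qed

lemma pos_of_real_diff: "star h = h \<Longrightarrow> norm h \<le> t \<Longrightarrow> pos (t *\<^sub>R 1 - h)"
  unfolding pos_def by (auto simp: star_simps intro!: exI[of _ t])

lemma pos_of_real_add: "star h = h \<Longrightarrow> norm h \<le> t \<Longrightarrow> pos (t *\<^sub>R 1 + h)"
  using pos_of_real_diff[of "- h" t] by (simp add: star_minus)

lemma star_scaleC_ii: "star (\<i> *\<^sub>C a) = - (\<i> *\<^sub>C star a)"
  by (simp add: star_scaleC)

text \<open>Since \<open>s + \<i>a\<close> is unitary.\<close>

lemma norm_le_one_of_squares_sum_one:
  fixes s a :: "'a::cstar_algebra"
  assumes "star s = s" "star a = a" "s * a = a * s" "s * s + a * a = 1"
  shows "norm s \<le> 1" "norm a \<le> 1"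
proof -
  define u where "u = s + \<i> *\<^sub>C a"
  have su: "star u = s - \<i> *\<^sub>C a" by (simp add: u_def star_add star_scaleC_ii assms)
  have "star u * u = (s - \<i> *\<^sub>C a) * (s + \<i> *\<^sub>C a)"
    unfolding su by (simp add: u_def)
  also have "\<dots> = s * s + \<i> *\<^sub>C (s * a) - \<i> *\<^sub>C (a * s) - \<i> *\<^sub>C \<i> *\<^sub>C (a * a)"
    by (simp add: distrib_left left_diff_distrib mult_scaleC_left mult_scaleC_right
        complex_vector.scale_right_distrib complex_vector.scale_right_diff_distrib)
  also have "\<dots> = 1" unfolding scaleC_ii_ii using assms(3,4) by simp
  finally have "(norm u)\<^sup>2 = 1" using norm_star_mult[of u] by simp
  then have n: "norm u = 1" "norm (star u) = 1"
    using norm_star[of u] by (simp_all add: power2_eq_1_iff) (use norm_ge_zero[of u] in linarith)+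
  have "2 *\<^sub>R s = u + star u" unfolding su by (simp add: u_def scaleR_2)
  then have "2 * norm s \<le> 2"
    using norm_triangle_ineq[of u "star u"] n by (metis norm_scaleR abs_numeral one_add_one)
  then show "norm s \<le> 1" by simp
  have "2 *\<^sub>R \<i> *\<^sub>C a = u - star u" unfolding su by (simp add: u_def scaleR_2)
  then have "norm (2 *\<^sub>R \<i> *\<^sub>C a) \<le> 2"
    using norm_triangle_ineq4[of u "star u"] n by simp
  then show "norm a \<le> 1" by (simp add: norm_scaleC)
qed

text \<open>The binomial series at \<open>x\<close>. The last conclusion is the tail bound of the
  coefficients and witnesses \<open>pos s\<close> with t = 1.\<close>

lemma (in unital_subalgebra) sqrt_one_minus_exists:
  assumes "x \<in> A" "star x = x" "norm x \<le> 1"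
  obtains s where "s \<in> A" "star s = s" "s * s = 1 - x" "norm (1 - s) \<le> 1"
proof -
  define s where "s = (\<Sum>k. sqrt_coeff k *\<^sub>R x ^ k)"
  have nk: "norm (x ^ k) \<le> 1" for k
    using norm_power_ineq[of x k] power_le_one[OF norm_ge_zero assms(3), of k] by linarith
  note series = sqrt_series[of 1 "\<lambda>k i j. x ^ k" "\<lambda>i j. s"]
  have sn: "summable (\<lambda>k. norm (sqrt_coeff k *\<^sub>R x ^ k))"
    by (rule series(1)[of 0 0]) (use nk in \<open>simp_all add: s_def power_add\<close>)
  have "(\<Sum>l<1::nat. s * s) = x ^ 0 - x ^ 1"
    by (rule series(2)[of 0 0]) (use nk in \<open>simp_all add: s_def power_add\<close>)
  then have "s * s = 1 - x" by simp
  note sm = summable_norm_cancel[OF sn]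
  have "star s = (\<Sum>k. star (sqrt_coeff k *\<^sub>R x ^ k))"
    unfolding s_def by (rule bounded_linear.suminf[OF bounded_linear_star sm])
  also have "star (x ^ k) = x ^ k" for k
    by (induction k) (simp_all add: star_mult assms(2) power_commutes)
  then have "(\<Sum>k. star (sqrt_coeff k *\<^sub>R x ^ k)) = s" by (simp add: s_def star_scaleR)
  finally have "star s = s" .
  have "s \<in> A" unfolding s_def using sm assms(1) by (intro suminf_mem) auto
  have "s = 1 + (\<Sum>k. sqrt_coeff (Suc k) *\<^sub>R x ^ Suc k)"
    unfolding s_def using suminf_split_head[OF sm] by (simp add: sqrt_coeff_0 algebra_simps)
  then have "norm (1 - s) = norm (\<Sum>k. sqrt_coeff (Suc k) *\<^sub>R x ^ Suc k)" by simp
  also have "\<dots> \<le> (\<Sum>k. norm (sqrt_coeff (Suc k) *\<^sub>R x ^ Suc k))"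
    using sn by (intro summable_norm) (subst summable_Suc_iff[of "\<lambda>k. norm (sqrt_coeff k *\<^sub>R x ^ k)"])
  also have "\<dots> \<le> (\<Sum>k. \<bar>sqrt_coeff (Suc k)\<bar>)"
  proof (rule suminf_le)
    show "norm (sqrt_coeff (Suc k) *\<^sub>R x ^ Suc k) \<le> \<bar>sqrt_coeff (Suc k)\<bar>" for k
      using nk[of "Suc k"] by (simp add: mult_left_le del: power_Suc)
    show "summable (\<lambda>k. norm (sqrt_coeff (Suc k) *\<^sub>R x ^ Suc k))"
      using sn by (subst summable_Suc_iff[of "\<lambda>k. norm (sqrt_coeff k *\<^sub>R x ^ k)"])
    show "summable (\<lambda>k. \<bar>sqrt_coeff (Suc k)\<bar>)"
      using summable_sqrt_coeff by (subst summable_Suc_iff)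
  qed
  also note sqrt_coeff_tail_le
  finally show ?thesis using that \<open>s \<in> A\<close> \<open>star s = s\<close> \<open>s * s = 1 - x\<close> by blast
qed

text \<open>After scaling to t = 1, the root s of 1 - b^2 makes s + ib unitary, so 1 - b^2 = s^2 has
  norm at most 1. This is how squares become positive without a spectrum.\<close>

lemma norm_of_real_minus_square:
  fixes a :: "'a::cstar_algebra"
  assumes sa: "star a = a" and t: "(norm a)\<^sup>2 \<le> t"
  shows "norm (t *\<^sub>R 1 - a * a) \<le> t"
proof (cases "t = 0")
  case True
  then show ?thesis using t by simp
next
  case False
  then have "t > 0" using t zero_le_power2[of "norm a"] by linarith
  define b where "b = (1 / sqrt t) *\<^sub>R a"
  have sb: "star b = b" by (simp add: b_def star_scaleR sa)
  have "norm a \<le> sqrt t" using t by (simp add: real_le_rsqrt)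
  then have nb: "norm b \<le> 1" using \<open>t > 0\<close> by (simp add: b_def)
  have "norm (b * b) \<le> 1" using norm_mult_ineq[of b b] nb by (simp add: mult_le_one order_trans)
  \<comment> \<open>Taking the root inside the commutant of \<open>b\<close> makes it commute with
    \<open>b\<close>.\<close>
  interpret c: unital_subalgebra "commutant {b}"
    by (rule unital_subalgebra_commutant) (simp add: sb)
  obtain s where s: "s \<in> commutant {b}" "star s = s" "s * s = 1 - b * b"
    using c.sqrt_one_minus_exists[of "b * b"] \<open>norm (b * b) \<le> 1\<close> sb
    by (auto simp: star_mult commutant_def mult.assoc)
  then have "norm s \<le> 1"
    using norm_le_one_of_squares_sum_one[of s b] sb by (auto simp: commutant_def)
  then have "norm (1 - b * b) \<le> 1"
    unfolding s(3)[symmetric] using norm_mult_ineq[of s s] by (simp add: mult_le_one order_trans)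
  moreover have "t *\<^sub>R 1 - a * a = t *\<^sub>R (1 - b * b)"
    using \<open>t > 0\<close> by (simp add: b_def algebra_simps)
  ultimately show ?thesis using \<open>t > 0\<close> by simp
qed

lemma pos_square: "star a = a \<Longrightarrow> pos (a * a)"
  unfolding pos_def using norm_of_real_minus_square by (auto simp: star_mult)

text \<open>For t > 0 the inequality in \<open>pos\<close> says that a / t = 1 - x with x of norm at
  most 1, which is where the binomial series applies.\<close>

lemma (in unital_subalgebra) pos_sqrt:
  assumes "pos a" "a \<in> A"
  obtains s where "s \<in> A" "pos s" "s * s = a"
proof -
  obtain t where t: "norm (t *\<^sub>R 1 - a) \<le> t" using assms(1) unfolding pos_def by blast
  show ?thesis
  proof (cases "t = 0")
    case True
    then show ?thesis using t that[of 0] by simp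
  next
    case False
    then have "t > 0" using t norm_ge_zero[of "t *\<^sub>R 1 - a"] by linarith
    have x: "1 - (1/t) *\<^sub>R a = (1/t) *\<^sub>R (t *\<^sub>R 1 - a)" using \<open>t > 0\<close> by (simp add: algebra_simps)
    have "norm (1 - (1/t) *\<^sub>R a) \<le> 1" unfolding x using t \<open>t > 0\<close> by simp
    then obtain s where s: "s \<in> A" "star s = s" "s * s = 1 - (1 - (1/t) *\<^sub>R a)" "norm (1 - s) \<le> 1"
      using sqrt_one_minus_exists[of "1 - (1/t) *\<^sub>R a"] assms
      by (auto simp: star_simps pos_star)
    show ?thesis
    proof (rule that[of "sqrt t *\<^sub>R s"])
      show "sqrt t *\<^sub>R s \<in> A" using s by auto
      have "pos s" unfolding pos_def using s by (auto intro!: exI[of _ 1])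
      then show "pos (sqrt t *\<^sub>R s)" using \<open>t > 0\<close> by (intro pos_scaleR) auto
      show "sqrt t *\<^sub>R s * sqrt t *\<^sub>R s = a" using s(3) \<open>t > 0\<close> by simp
    qed
  qed
qed

lemma unital_subalgebra_UNIV: "unital_subalgebra (UNIV :: 'a::cstar_algebra set)"
  by unfold_locales (simp_all add: cstar_subalgebra_def)

text \<open>Positivity provides some witness t. Since \<open>a\<close> is the square of a
  self-adjoint element whose squared norm is \<open>norm a\<close>, every bound of the norm is a
  witness.\<close>

lemma pos_norm_diff:
  fixes a :: "'a::cstar_algebra"
  assumes "pos a" "norm a \<le> t"
  shows "norm (t *\<^sub>R 1 - a) \<le> t"
proof -
  obtain s :: 'a where s: "pos s" "s * s = a"
    using unital_subalgebra.pos_sqrt[OF unital_subalgebra_UNIV assms(1)] by auto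
  then have "(norm s)\<^sup>2 = norm a" using norm_star_mult[of s] by (simp add: pos_star)
  then show ?thesis using norm_of_real_minus_square[of s t] s assms(2) by (simp add: pos_star)
qed

text \<open>A form of closedness of the cone: the single witness \<open>norm a + 1\<close> serves
  all perturbations of size at most 1 and so survives the limit.\<close>

lemma pos_of_pos_add:
  fixes a :: "'a::cstar_algebra"
  assumes "\<And>e. 0 < e \<Longrightarrow> pos (a + e *\<^sub>R 1)"
  shows "pos a"
proof -
  have "norm ((norm a + 1) *\<^sub>R 1 - a) \<le> (norm a + 1) + e" if "0 < e" for e
  proof -
    define d where "d = min e 1"
    have d: "0 < d" "d \<le> 1" "d \<le> e" using that by (auto simp: d_def)
    have "norm (a + d *\<^sub>R 1) \<le> norm a + 1"
      using norm_triangle_ineq[of a "d *\<^sub>R 1"] d by simp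
    then have "norm ((norm a + 1) *\<^sub>R 1 - (a + d *\<^sub>R 1)) \<le> norm a + 1"
      using assms d by (intro pos_norm_diff) auto
    moreover have "(norm a + 1) *\<^sub>R 1 - a = ((norm a + 1) *\<^sub>R 1 - (a + d *\<^sub>R 1)) + d *\<^sub>R 1"
      by (simp add: algebra_simps)
    then have "norm ((norm a + 1) *\<^sub>R 1 - a)
        \<le> norm ((norm a + 1) *\<^sub>R 1 - (a + d *\<^sub>R 1)) + norm (d *\<^sub>R (1::'a))"
      by (metis norm_triangle_ineq)
    ultimately show ?thesis using d by simp
  qed
  then have "norm ((norm a + 1) *\<^sub>R 1 - a) \<le> norm a + 1" by (rule field_le_epsilon)
  moreover have "star a = a" using pos_star[OF assms[of 1]] by (simp add: star_add)
  ultimately show ?thesis by (auto simp: pos_def)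
qed

lemma (in abelian_subalgebra) pos_mult:
  assumes "pos a" "a \<in> A" "pos b" "b \<in> A"
  shows "pos (a * b)"
proof -
  obtain s u where s: "s \<in> A" "pos s" "s * s = a" and u: "u \<in> A" "pos u" "u * u = b"
    using pos_sqrt[OF assms(1,2)] pos_sqrt[OF assms(3,4)] by metis
  have "pos ((s * u) * (s * u))"
    using s u by (intro pos_square) (simp add: star_mult pos_star commute)
  moreover have "(s * u) * (s * u) = a * b"
    using s u commute by (metis mult.assoc)
  ultimately show ?thesis by simp
qed

text \<open>For l > t the product of l - h and l + h is positive, hence a square s^2. Then s^2 + h^2
  = l^2, so (s + ih) / l is unitary.\<close>

lemma norm_le_of_pos:
  fixes h :: "'a::cstar_algebra"
  assumes "pos (t *\<^sub>R 1 - h)" "pos (t *\<^sub>R 1 + h)" "0 \<le> t"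
  shows "norm h \<le> t"
proof (rule field_le_epsilon)
  fix e :: real assume "0 < e"
  \<comment> \<open>The margin \<open>e\<close> keeps \<open>l\<close> positive, so that it can be
    divided by even if t = 0.\<close>
  define l where "l = t + e"
  have "l > 0" using \<open>0 < e\<close> assms(3) by (simp add: l_def)
  have p: "pos (l *\<^sub>R 1 - h)" "pos (l *\<^sub>R 1 + h)"
    using pos_add[OF assms(1) pos_of_real[of e]] pos_add[OF assms(2) pos_of_real[of e]] \<open>0 < e\<close>
    by (simp_all add: l_def algebra_simps)
  have sa: "star h = h" using pos_star[OF p(1)] by (simp add: star_simps)
  obtain A where A: "abelian_subalgebra A" "h \<in> A"
    using abelian_subalgebra_containing[OF sa] by metis
  interpret abelian_subalgebra A by (rule A)
  have "pos ((l *\<^sub>R 1 - h) * (l *\<^sub>R 1 + h))"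
    using p A by (intro pos_mult) auto
  moreover have "(l *\<^sub>R 1 - h) * (l *\<^sub>R 1 + h) \<in> A" using A by auto
  ultimately obtain s where s: "s \<in> A" "pos s" "s * s = (l *\<^sub>R 1 - h) * (l *\<^sub>R 1 + h)"
    by (rule pos_sqrt)
  have "s * s + h * h = (l * l) *\<^sub>R 1"
    unfolding s(3) by (simp add: algebra_simps)
  then have "((1/l) *\<^sub>R s) * ((1/l) *\<^sub>R s) + ((1/l) *\<^sub>R h) * ((1/l) *\<^sub>R h) = 1"
    using \<open>l > 0\<close> by (simp flip: scaleR_add_right)
  then have "norm ((1/l) *\<^sub>R h) \<le> 1"
    using s sa commute[OF s(1) A(2)]
    by (intro norm_le_one_of_squares_sum_one(2)[of "(1/l) *\<^sub>R s"]) (auto simp: star_scaleR pos_star)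
  then show "norm h \<le> t + e" using \<open>l > 0\<close> by (simp add: l_def[symmetric])
qed

lemma norm_mono_pos:
  assumes "pos a" "pos (b - a)"
  shows "norm a \<le> norm b"
proof -
  have b: "star b = b" using pos_star[OF assms(1)] pos_star[OF assms(2)] by (simp add: star_diff)
  have "pos (norm b *\<^sub>R 1 - a)"
    using pos_add[OF pos_of_real_diff[OF b order_refl] assms(2)] by simp
  moreover have "pos (norm b *\<^sub>R 1 + a)"
    by (intro pos_add pos_of_real assms) simp
  ultimately show ?thesis by (rule norm_le_of_pos) simp
qed

lemma pos_antisym: "pos a \<Longrightarrow> pos (- a) \<Longrightarrow> a = 0"
  using norm_mono_pos[of a 0] by simp

text \<open>Neumann series for c = t (1 - x): subtracting \<open>d\<close> first gives x norm
  strictly below 1. The inverse r is positive because r = c r^2.\<close>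

lemma (in abelian_subalgebra) inverse_exists:
  assumes "c \<in> A" "pos (c - d *\<^sub>R 1)" "0 < d"
  obtains r where "r \<in> A" "pos r" "c * r = 1"
proof -
  define t where "t = norm (c - d *\<^sub>R 1) + d"
  have "t > 0" using assms(3) by (simp add: t_def add_nonneg_pos)
  have "(norm (c - d *\<^sub>R 1)) *\<^sub>R 1 - (c - d *\<^sub>R 1) = t *\<^sub>R 1 - c" by (simp add: t_def algebra_simps)
  then have "norm (t *\<^sub>R 1 - c) \<le> norm (c - d *\<^sub>R 1)"
    using pos_norm_diff[OF assms(2) order_refl] by (simp only:)
  then have "norm (t *\<^sub>R 1 - c) < t" using assms(3) by (simp add: t_def)
  define x where "x = (1/t) *\<^sub>R (t *\<^sub>R 1 - c)"
  have "norm x < 1" using \<open>norm (t *\<^sub>R 1 - c) < t\<close> \<open>t > 0\<close> by (simp add: x_def)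
  then have sm: "summable (\<lambda>n. x ^ n)" by (rule complete_algebra_summable_geometric)
  define y where "y = (\<Sum>n. x ^ n)"
  have "y = 1 + x * y"
    unfolding y_def using suminf_split_head[OF sm] suminf_mult[OF sm, of x] by simp
  have pc: "pos c" using pos_add[OF assms(2) pos_of_real[of d]] assms(3) by simp
  have "star x = x" by (simp add: x_def star_simps pos_star[OF pc])
  then have "star (x ^ n) = x ^ n" for n by (induction n) (simp_all add: star_mult power_commutes)
  then have sy: "star y = y"
    unfolding y_def by (subst bounded_linear.suminf[OF bounded_linear_star sm]) simp
  have "x \<in> A" using assms(1) by (auto simp: x_def simp del: scaleR_right_diff_distrib)
  then have y: "y \<in> A" unfolding y_def using sm by (intro suminf_mem) auto
  have "c * ((1/t) *\<^sub>R y) = y - x * y"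
    using \<open>t > 0\<close> by (simp add: x_def algebra_simps)
  also have "\<dots> = 1" using \<open>y = 1 + x * y\<close> by (simp add: algebra_simps)
  finally have inv: "c * ((1/t) *\<^sub>R y) = 1" .
  define r where "r = (1/t) *\<^sub>R y"
  have r: "r \<in> A" "star r = r" "c * r = 1" using y sy inv by (auto simp: r_def star_scaleR)
  have "pos (c * (r * r))" using r assms(1) pc by (intro pos_mult pos_square) auto
  then have "pos r" using r by (simp flip: mult.assoc)
  then show ?thesis using that r by blast
qed

text \<open>As functions, \<open>a\<close> and \<open>b\<close> have disjoint supports. The shifted
  sum \<open>c\<close> has a positive inverse, and a b = 0 makes p c a sum of positive terms;
  dividing by \<open>c\<close> gives p = a + e positive.\<close>

lemma (in abelian_subalgebra) pos_of_sum_of_prod: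
  assumes "a \<in> A" "b \<in> A" "pos (a + b)" "a * b = 0" "star a = a"
  shows "pos a"
proof (rule pos_of_pos_add)
  fix e :: real assume e: "0 < e"
  define p where "p = a + e *\<^sub>R 1"
  define c where "c = a + b + (2 * e) *\<^sub>R 1"
  have mem: "p \<in> A" "c \<in> A" using assms by (auto simp: p_def c_def)
  have "pos (c - (2 * e) *\<^sub>R 1)" using assms by (simp add: c_def)
  then obtain r where r: "r \<in> A" "pos r" "c * r = 1"
    using inverse_exists[of c "2 * e"] mem e by auto
  have "p * c = p * p + (e *\<^sub>R (a + b) + (e * e) *\<^sub>R 1)"
    using assms(4) by (simp add: p_def c_def algebra_simps mult_2 flip: scaleR_add_left)
  moreover have "pos (p * p)" using assms(5) by (intro pos_square) (simp add: p_def star_simps)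
  ultimately have "pos (p * c)" using assms(3) e by (auto intro!: pos_add pos_scaleR)
  then have "pos (p * c * r)" using mem r by (intro pos_mult[of "p * c"]) auto
  then show "pos (a + e *\<^sub>R 1)" using r(3) by (simp add: mult.assoc p_def)
qed

text \<open>With s the absolute value of h, the candidates (s + h) / 2 and (s - h) / 2 have positive
  sum s and product 0, so each of them is positive.\<close>

lemma (in abelian_subalgebra) pos_parts:
  assumes "h \<in> A" "star h = h"
  obtains a b where "a \<in> A" "b \<in> A" "pos a" "pos b" "h = a - b" "a * b = 0"
proof -
  obtain s where s: "s \<in> A" "pos s" "s * s = h * h"
    using pos_sqrt[of "h * h"] assms pos_square by auto
  define a b where "a = (1/2) *\<^sub>R (s + h)" and "b = (1/2) *\<^sub>R (s - h)"
  have ab: "a \<in> A" "b \<in> A" "a + b = s" "a - b = h" "star a = a" "star b = b"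
    using assms s by (auto simp: a_def b_def star_simps pos_star scaleR_2[symmetric]
        simp flip: scaleR_add_right scaleR_diff_right)
  have "(s + h) * (s - h) = 0"
    using s(3) commute[OF s(1) assms(1)] by (simp add: algebra_simps)
  then have "a * b = 0" by (simp add: a_def b_def)
  moreover have "b * a = 0" using \<open>a * b = 0\<close> commute ab by simp
  moreover have "pos a" "pos b"
    using pos_of_sum_of_prod[of a b] pos_of_sum_of_prod[of b a] ab s calculation
    by (auto simp: add.commute)
  ultimately show ?thesis using that ab by metis
qed

text \<open>Replaces the fact that \<open>star y * y\<close> and \<open>y * star y\<close> have the
  same nonzero spectrum. Their sum is 2 a^2 + 2 b^2, so with \<open>k\<close> also \<open>g\<close>
  is positive. Its norm \<open>m\<close> would then be a spectral value of \<open>g\<close>, but m -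
  g is invertible because m + k is.\<close>

lemma eq_zero_of_pos_minus_star_mult:
  fixes y :: "'a::cstar_algebra"
  assumes "pos (- (star y * y))"
  shows "y = 0"
proof (rule ccontr)
  assume "y \<noteq> 0"
  define k where "k = - (star y * y)"
  define g where "g = y * star y"
  define m where "m = norm g"
  have "pos k" using assms by (simp add: k_def)
  obtain a b where ab: "star a = a" "star b = b" "y = a + \<i> *\<^sub>C b"
    by (rule cartesian_decomposition)
  have "star y * y + y * star y = 2 *\<^sub>R (a * a) + 2 *\<^sub>R (b * b)"
    unfolding ab(3) star_add star_scaleC_ii ab(1,2)
    by (simp add: algebra_simps mult_scaleC_left mult_scaleC_right scaleC_ii_ii scaleR_2
        scaleC_uminus complex_vector.scale_right_distrib complex_vector.scale_right_diff_distrib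
        del: complex_vector.scale_scale)
  then have "g = 2 *\<^sub>R (a * a) + 2 *\<^sub>R (b * b) + k" by (simp add: g_def k_def algebra_simps)
  then have "pos g" using \<open>pos k\<close> ab by (auto intro!: pos_add pos_scaleR pos_square)
  have "m > 0" using \<open>y \<noteq> 0\<close> eq_zero_of_mult_star[of y] by (auto simp: m_def g_def)
  obtain r where r: "pos r" "(m *\<^sub>R 1 + k) * r = 1" "r * (m *\<^sub>R 1 + k) = 1"
  proof -
    obtain A where A: "abelian_subalgebra A" "k \<in> A"
      using abelian_subalgebra_containing[OF pos_star[OF \<open>pos k\<close>]] by metis
    interpret abelian_subalgebra A by (rule A)
    have m: "m *\<^sub>R 1 + k \<in> A" using A by auto
    obtain r where "r \<in> A" "pos r" "(m *\<^sub>R 1 + k) * r = 1"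
      using inverse_exists[of "m *\<^sub>R 1 + k" m] \<open>pos k\<close> \<open>m > 0\<close> m by auto
    then show ?thesis using that commute[of r] m by metis
  qed
  \<comment> \<open>The standard formula for the inverse of m - y \<open>star y\<close> in terms of
    the inverse r of m - \<open>star y\<close> y = m + k.\<close>
  define R where "R = (1/m) *\<^sub>R (1 + y * r * star y)"
  have "(m *\<^sub>R 1 - g) * (1 + y * r * star y)
      = m *\<^sub>R 1 - g + y * ((m *\<^sub>R 1 + k) * r) * star y"
    by (simp add: g_def k_def algebra_simps)
  then have R1: "(m *\<^sub>R 1 - g) * R = 1"
    using r \<open>m > 0\<close> by (simp add: R_def g_def)
  have "(1 + y * r * star y) * (m *\<^sub>R 1 - g)
      = m *\<^sub>R 1 - g + y * (r * (m *\<^sub>R 1 + k)) * star y"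
    by (simp add: g_def k_def algebra_simps)
  then have R2: "R * (m *\<^sub>R 1 - g) = 1"
    using r \<open>m > 0\<close> by (simp add: R_def g_def)
  have sR: "star R = R" by (simp add: R_def star_simps pos_star[OF r(1)] mult.assoc)
  obtain A where A: "abelian_subalgebra A" "g \<in> A"
    "\<And>x. (\<And>y. g * y = y * g \<Longrightarrow> x * y = y * x) \<Longrightarrow> x \<in> A"
    using abelian_subalgebra_containing[OF pos_star[OF \<open>pos g\<close>]] by metis
  interpret abelian_subalgebra A by (rule A)
  have "R \<in> A"
  proof (rule A(3))
    fix z assume "g * z = z * g"
    then have "(m *\<^sub>R 1 - g) * z = z * (m *\<^sub>R 1 - g)" by (simp add: algebra_simps)
    then have "R * (m *\<^sub>R 1 - g) * z * R = R * z * ((m *\<^sub>R 1 - g) * R)" by (simp add: mult.assoc)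
    then show "R * z = z * R" unfolding R1 R2 by simp
  qed
  have "R \<noteq> 0" using R1 by auto
  define n where "n = norm R"
  have "n > 0" using \<open>R \<noteq> 0\<close> by (simp add: n_def)
  \<comment> \<open>Quantitative invertibility: multiplying n - R by m - g gives n (m - g) - 1, so
    \<open>g\<close> is at most m - 1/n, against \<open>norm g = m\<close>.\<close>
  have "pos ((m *\<^sub>R 1 - g) * (n *\<^sub>R 1 - R))"
    using \<open>R \<in> A\<close> A(2) sR pos_star[OF \<open>pos g\<close>]
    by (intro pos_mult pos_of_real_diff) (auto simp: m_def n_def)
  then have "pos ((1/n) *\<^sub>R ((m *\<^sub>R 1 - g) * (n *\<^sub>R 1 - R)))"
    using \<open>n > 0\<close> by (intro pos_scaleR) auto
  moreover have "(1/n) *\<^sub>R ((m *\<^sub>R 1 - g) * (n *\<^sub>R 1 - R)) = (m - 1/n) *\<^sub>R 1 - g"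
    unfolding right_diff_distrib R1 using \<open>n > 0\<close> by (simp add: algebra_simps)
  ultimately have p: "pos ((m - 1/n) *\<^sub>R 1 - g)" by simp
  have "0 \<le> m - 1/n"
    using pos_add[OF p \<open>pos g\<close>] by (intro of_real_pos_nonneg[where 'a = 'a]) simp
  then have "norm g \<le> m - 1/n"
    using p pos_add[OF pos_of_real[of "m - 1/n"] \<open>pos g\<close>] by (intro norm_le_of_pos) auto
  then show False using \<open>n > 0\<close> by (simp add: m_def)
qed

text \<open>Cutting down by the negative part b of h = \<open>star w * w\<close> gives b h b = -
  b^3, so w b falls under the previous lemma and vanishes; then b^3 = 0 and b = 0.\<close>

lemma pos_star_mult: "pos (star w * w)"
proof -
  define h where "h = star w * w"
  have sa: "star h = h" by (simp add: h_def star_mult star_star)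
  obtain A where A: "abelian_subalgebra A" "h \<in> A"
    using abelian_subalgebra_containing[OF sa] by metis
  interpret abelian_subalgebra A by (rule A)
  obtain a b where ab: "a \<in> A" "b \<in> A" "pos a" "pos b" "h = a - b" "a * b = 0"
    using pos_parts[OF A(2) sa] by metis
  have "star (w * b) * (w * b) = b * h * b"
    by (simp add: star_mult pos_star[OF ab(4)] h_def mult.assoc)
  also have "\<dots> = (b * a) * b - b * b * b"
    unfolding ab(5) by (simp add: algebra_simps)
  also have "b * a = 0" using ab commute by simp
  also have "0 * b - b * b * b = - (b * b * b)" by simp
  finally have eq: "star (w * b) * (w * b) = - (b * b * b)" .
  have "pos (b * b * b)" using ab by (intro pos_mult) auto
  then have "w * b = 0" using eq by (intro eq_zero_of_pos_minus_star_mult) simp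
  then have "b * b * b = 0" using eq by simp
  then have "star (b * b) * (b * b) = 0" by (simp add: star_mult pos_star[OF ab(4)] flip: mult.assoc)
  then have "star b * b = 0" using eq_zero_of_star_mult[of "b * b"] by (simp add: pos_star[OF ab(4)])
  then have "b = 0" by (rule eq_zero_of_star_mult)
  then show ?thesis using ab by (simp add: h_def)
qed

section \<open>Positive matrices over a C*-algebra\<close>

lemma pos_conj: "pos p \<Longrightarrow> pos (star y * p * y)"
proof -
  assume "pos p"
  then obtain s where "pos s" "s * s = p"
    using unital_subalgebra.pos_sqrt[OF unital_subalgebra_UNIV] by auto
  then show ?thesis
    using pos_star_mult[of "s * y"] by (auto simp: star_mult pos_star mult.assoc)
qed

lemma pos_one_minus_star_mult: "norm u \<le> 1 \<Longrightarrow> pos (1 - star u * u)"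
  using pos_of_real_diff[of "star u * u" 1] norm_star_mult[of u]
  by (simp add: star_mult star_star power_le_one)

text \<open>Completing the square: for m = N u the difference is N times |x - u y|^2 +
  \<open>star y\<close> (1 - |u|^2) y, where |u|^2 means \<open>star u * u\<close>.\<close>

lemma pos_cross_terms_bound:
  fixes m x y :: "'a::cstar_algebra"
  assumes "norm m \<le> N"
  shows "pos (N *\<^sub>R (star x * x + star y * y) - (star x * m * y + star y * star m * x))"
proof (cases "N = 0")
  case True
  then show ?thesis using assms by simp
next
  case False
  then have "N > 0" using assms norm_ge_zero[of m] by linarith
  define u where "u = (1/N) *\<^sub>R m"
  have m: "m = N *\<^sub>R u" using \<open>N > 0\<close> by (simp add: u_def)
  have "norm u \<le> 1" using assms \<open>N > 0\<close> by (simp add: u_def)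
  then have "pos (N *\<^sub>R (star (x - u * y) * (x - u * y) + star y * (1 - star u * u) * y))"
    using \<open>N > 0\<close> by (intro pos_scaleR pos_add pos_star_mult pos_conj pos_one_minus_star_mult) auto
  moreover have "N *\<^sub>R (star x * x + star y * y) - (star x * m * y + star y * star m * x)
      = N *\<^sub>R (star (x - u * y) * (x - u * y) + star y * (1 - star u * u) * y)"
    by (simp add: m star_simps algebra_simps)
  ultimately show ?thesis by simp
qed

text \<open>The algebra-valued inner product of a Hilbert module; order relations between matrices
  are expressed through it.\<close>

definition vec_inner :: "nat \<Rightarrow> (nat \<Rightarrow> 'a) \<Rightarrow> (nat \<Rightarrow> 'a) \<Rightarrow> 'a::cstar_algebra" where
  "vec_inner n x y = (\<Sum>i<n. star (x i) * y i)"

definition mat_vec :: "nat \<Rightarrow> (nat \<Rightarrow> nat \<Rightarrow> 'a) \<Rightarrow> (nat \<Rightarrow> 'a) \<Rightarrow> nat \<Rightarrow> 'a::cstar_algebra" where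
  "mat_vec n T x i = (\<Sum>j<n. T i j * x j)"

fun mat_power :: "nat \<Rightarrow> (nat \<Rightarrow> nat \<Rightarrow> 'a) \<Rightarrow> nat \<Rightarrow> nat \<Rightarrow> nat \<Rightarrow> 'a::cstar_algebra" where
  "mat_power n T 0 i j = (if i = j then 1 else 0)"
| "mat_power n T (Suc k) i j = (\<Sum>l<n. T i l * mat_power n T k l j)"

lemma vec_inner_diff:
  "vec_inner n (\<lambda>i. x i - y i) z = vec_inner n x z - vec_inner n y z"
  "vec_inner n x (\<lambda>i. y i - z i) = vec_inner n x y - vec_inner n x z"
  by (simp_all add: vec_inner_def star_diff algebra_simps sum_subtractf)

lemma mat_vec_diff: "mat_vec n T (\<lambda>i. x i - y i) = (\<lambda>i. mat_vec n T x i - mat_vec n T y i)"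
  by (rule ext) (simp add: mat_vec_def algebra_simps sum_subtractf)

lemma pos_vec_inner_self: "pos (vec_inner n x x)"
  unfolding vec_inner_def by (intro pos_sum pos_star_mult)

lemma vec_inner_mat_vec:
  "vec_inner n x (mat_vec n T y) = (\<Sum>i<n. \<Sum>j<n. star (x i) * T i j * y j)"
  by (simp add: vec_inner_def mat_vec_def sum_distrib_left mult.assoc)

lemma vec_inner_mat_vec_hermitian:
  assumes "\<And>i j. i < n \<Longrightarrow> j < n \<Longrightarrow> star (T i j) = T j i"
  shows "vec_inner n (mat_vec n T x) y = vec_inner n x (mat_vec n T y)"
proof -
  have "vec_inner n (mat_vec n T x) y = (\<Sum>i<n. \<Sum>j<n. star (x j) * T j i * y i)"
    by (simp add: vec_inner_def mat_vec_def star_sum sum_distrib_right star_mult assms mult.assoc)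
  also have "\<dots> = vec_inner n x (mat_vec n T y)"
    unfolding vec_inner_mat_vec by (rule sum.swap)
  finally show ?thesis .
qed

lemma mat_power_add:
  assumes "i < n"
  shows "mat_power n T (a + b) i j = (\<Sum>l<n. mat_power n T a i l * mat_power n T b l j)"
  using assms
proof (induction a arbitrary: i)
  case 0
  have "(\<Sum>l<n. mat_power n T 0 i l * mat_power n T b l j)
      = (\<Sum>l<n. if l = i then mat_power n T b i j else 0)"
    by (intro sum.cong) auto
  then show ?case using 0 by simp
next
  case (Suc a)
  have "mat_power n T (Suc a + b) i j
      = (\<Sum>l<n. \<Sum>p<n. T i l * (mat_power n T a l p * mat_power n T b p j))"
    using Suc.IH by (simp add: sum_distrib_left)
  also have "\<dots> = (\<Sum>p<n. \<Sum>l<n. T i l * (mat_power n T a l p * mat_power n T b p j))"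
    by (rule sum.swap)
  finally show ?case by (simp add: sum_distrib_right mult.assoc)
qed

lemma mat_power_1:
  assumes "j < n"
  shows "mat_power n T 1 i j = T i j"
proof -
  have "(\<Sum>l<n. T i l * mat_power n T 0 l j) = (\<Sum>l<n. if l = j then T i j else 0)"
    by (intro sum.cong) auto
  then show ?thesis using assms by simp
qed

lemma star_mat_power:
  assumes "\<And>i j. i < n \<Longrightarrow> j < n \<Longrightarrow> star (T i j) = T j i" "i < n" "j < n"
  shows "star (mat_power n T k i j) = mat_power n T k j i"
  using assms(2,3)
proof (induction k arbitrary: i j)
  case (Suc k)
  have "star (mat_power n T (Suc k) i j) = (\<Sum>l<n. mat_power n T k j l * T l i)"
    using Suc by (simp add: star_sum star_mult assms(1))
  also have "\<dots> = mat_power n T (k + 1) j i"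
    unfolding mat_power_add[OF Suc.prems(2)] using Suc.prems by (intro sum.cong) (auto simp: mat_power_1 simp del: mat_power.simps One_nat_def)
  finally show ?case by simp
qed auto

text \<open>A positive matrix with \<open>0 \<le> T \<le> 1\<close> satisfies \<open>T\<^sup>2 \<le> T\<close>, hence its powers are contractions.\<close>

lemma norm_mat_power_le_one:
  fixes T :: "nat \<Rightarrow> nat \<Rightarrow> 'a::cstar_algebra"
  assumes herm: "\<And>i j. i < n \<Longrightarrow> j < n \<Longrightarrow> star (T i j) = T j i"
    and closed: "\<And>x i. (\<And>j. j < n \<Longrightarrow> x j \<in> A) \<Longrightarrow> i < n \<Longrightarrow> mat_vec n T x i \<in> A"
    and A: "0 \<in> A" "1 \<in> A" "\<And>x y. x \<in> A \<Longrightarrow> y \<in> A \<Longrightarrow> x - y \<in> A"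
    and ge: "\<And>x. (\<And>i. i < n \<Longrightarrow> x i \<in> A) \<Longrightarrow> pos (vec_inner n x (mat_vec n T x))"
    and le: "\<And>x. (\<And>i. i < n \<Longrightarrow> x i \<in> A) \<Longrightarrow>
      pos (vec_inner n x x - vec_inner n x (mat_vec n T x))"
    and ij: "i < n" "j < n"
  shows "norm (mat_power n T k i j) \<le> 1"
proof -
  have step: "pos (vec_inner n x x - vec_inner n (mat_vec n T x) (mat_vec n T x))"
    if x: "\<And>i. i < n \<Longrightarrow> x i \<in> A" for x
  proof -
    define y where "y = mat_vec n T x"
    have y: "y i \<in> A" if "i < n" for i using closed x that by (simp add: y_def)
    define z where "z = (\<lambda>i. x i - y i)"
    have z: "z i \<in> A" if "i < n" for i using A x y that by (simp add: z_def)
    have "vec_inner n x (mat_vec n T y) = vec_inner n y y"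
      using vec_inner_mat_vec_hermitian[OF herm] by (simp add: y_def)
    then have "vec_inner n z (mat_vec n T z)
        = vec_inner n x y - 2 *\<^sub>R vec_inner n y y + vec_inner n y (mat_vec n T y)"
      by (simp add: z_def mat_vec_diff vec_inner_diff flip: y_def) (simp add: scaleR_2)
    \<comment> \<open>In operator form: 1 - T^2 = (1 - T) + T (1 - T) T + (1 - T) T (1 - T).\<close>
    then have "vec_inner n x x - vec_inner n y y = (vec_inner n x x - vec_inner n x y)
        + (vec_inner n y y - vec_inner n y (mat_vec n T y)) + vec_inner n z (mat_vec n T z)"
      by (simp add: scaleR_2)
    moreover have "pos (vec_inner n x x - vec_inner n x y)" using le[of x] x by (simp add: y_def)
    moreover have "pos (vec_inner n y y - vec_inner n y (mat_vec n T y))" using le[of y] y by simp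
    moreover have "pos (vec_inner n z (mat_vec n T z))" using ge[of z] z by simp
    ultimately show ?thesis unfolding y_def[symmetric] by (metis pos_add)
  qed
  \<comment> \<open>\<open>u k\<close> is column \<open>j\<close> of the k-th power; its inner
    square is at most 1 and dominates the square of each entry.\<close>
  define u where "u k = (\<lambda>i. mat_power n T k i j)" for k
  have u_Suc: "u (Suc k) = mat_vec n T (u k)" for k
    by (rule ext) (simp add: u_def mat_vec_def)
  \<comment> \<open>The inequalities on \<open>T\<close> are assumed for tuples over
    \<open>A\<close> only, so the columns have to stay in \<open>A\<close>.\<close>
  have u: "u k i \<in> A" if "i < n" for k i
    using that
  proof (induction k arbitrary: i)
    case 0
    then show ?case using A by (simp add: u_def)
  next
    case (Suc k)
    then show ?case unfolding u_Suc by (intro closed)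
  qed
  have "pos (1 - vec_inner n (u k) (u k))"
  proof (induction k)
    case 0
    have "vec_inner n (u 0) (u 0) = (\<Sum>i<n. if i = j then 1 else 0)"
      unfolding vec_inner_def u_def by (intro sum.cong) auto
    then show ?case using ij by simp
  next
    case (Suc k)
    show ?case using pos_add[OF Suc step[of "u k"]] u unfolding u_Suc by simp
  qed
  moreover have "pos (vec_inner n (u k) (u k) - star (u k i) * u k i)"
  proof -
    have "vec_inner n (u k) (u k) = star (u k i) * u k i + (\<Sum>l\<in>{..<n} - {i}. star (u k l) * u k l)"
      unfolding vec_inner_def using ij by (intro sum.remove) auto
    then show ?thesis by (simp add: pos_sum pos_star_mult)
  qed
  ultimately have "pos (1 - star (u k i) * u k i)" using pos_add by force
  then have "norm (star (u k i) * u k i) \<le> norm (1::'a)"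
    by (intro norm_mono_pos pos_star_mult)
  then show ?thesis by (simp add: norm_star_mult u_def power_le_one_iff abs_square_le_1)
qed

text \<open>T = 1 - X / r lies between 0 and 1, which bounds the entries of its powers. The binomial
  series then converges entrywise to a hermitian root Z of X / r.\<close>

lemma (in unital_subalgebra) matrix_factorization:
  fixes X :: "nat \<Rightarrow> nat \<Rightarrow> 'a"
  assumes X: "\<And>i j. i < n \<Longrightarrow> j < n \<Longrightarrow> X i j \<in> A"
    and herm: "\<And>i j. i < n \<Longrightarrow> j < n \<Longrightarrow> star (X i j) = X j i"
    and form: "\<And>x. (\<And>i. i < n \<Longrightarrow> x i \<in> A) \<Longrightarrow> pos (\<Sum>i<n. \<Sum>j<n. star (x i) * X i j * x j)"
  obtains Z where "\<And>i j. i < n \<Longrightarrow> j < n \<Longrightarrow> Z i j \<in> A"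
    "\<And>i j. i < n \<Longrightarrow> j < n \<Longrightarrow> X i j = (\<Sum>k<n. star (Z k i) * Z k j)"
proof -
  define N where "N = (\<Sum>i<n. \<Sum>j<n. norm (X i j))"
  \<comment> \<open>Adding the cross term bounds over all index pairs gives the upper bound n N for
    \<open>X\<close>; the extra 1 makes \<open>r\<close> positive.\<close>
  define r where "r = real n * N + 1"
  define T where "T i j = (if i = j then 1 else 0) - (1/r) *\<^sub>R X i j" for i j
  have N: "norm (X i j) \<le> N" if "i < n" "j < n" for i j
  proof -
    have "norm (X i j) \<le> (\<Sum>j<n. norm (X i j))" using that by (intro member_le_sum) auto
    also have "\<dots> \<le> N" unfolding N_def
      using that by (intro member_le_sum[of i _ "\<lambda>i. \<Sum>j<n. norm (X i j)"]) (auto intro: sum_nonneg)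
    finally show ?thesis .
  qed
  have "0 \<le> N" unfolding N_def by (intro sum_nonneg) auto
  then have "r > 0" by (simp add: r_def add_nonneg_pos)
  have mvT: "mat_vec n T x i = x i - (1/r) *\<^sub>R mat_vec n X x i" if "i < n" for x i
  proof -
    have "mat_vec n T x i = (\<Sum>j<n. (if j = i then x i else 0)) - (1/r) *\<^sub>R mat_vec n X x i"
      unfolding mat_vec_def scaleR_sum_right sum_subtractf[symmetric] T_def
      by (intro sum.cong) (auto simp: algebra_simps)
    then show ?thesis using that by simp
  qed
  have inner_T: "vec_inner n y (mat_vec n T x) = vec_inner n y x - (1/r) *\<^sub>R vec_inner n y (mat_vec n X x)"
    for x y
  proof -
    have "vec_inner n y (mat_vec n T x) = vec_inner n y (\<lambda>i. x i - (1/r) *\<^sub>R mat_vec n X x i)"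
      unfolding vec_inner_def by (intro sum.cong) (simp_all add: mvT)
    then show ?thesis unfolding vec_inner_diff by (simp add: vec_inner_def scaleR_sum_right)
  qed
  have hermT: "star (T i j) = T j i" if "i < n" "j < n" for i j
    using herm that by (simp add: T_def star_simps)
  have TA: "T i j \<in> A" if "i < n" "j < n" for i j
    using X that by (auto simp: T_def)
  have X_le: "pos (r *\<^sub>R vec_inner n x x - vec_inner n x (mat_vec n X x))" for x
  proof -
    let ?g = "\<lambda>i j. N *\<^sub>R (star (x i) * x i + star (x j) * x j)
        - (star (x i) * X i j * x j + star (x j) * star (X i j) * x i)"
    have "pos (\<Sum>i<n. \<Sum>j<n. ?g i j)"
      using N by (intro pos_sum pos_cross_terms_bound) auto
    moreover have "(\<Sum>i<n. \<Sum>j<n. ?g i j)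
      = 2 *\<^sub>R ((real n * N) *\<^sub>R vec_inner n x x - vec_inner n x (mat_vec n X x))"
    proof -
      have 1: "(\<Sum>i<n. \<Sum>j<n. star (x i) * x i) = real n *\<^sub>R vec_inner n x x"
        by (simp add: vec_inner_def scaleR_sum_right sum_constant_scaleR del: sum_constant)
      have 2: "(\<Sum>i<n. \<Sum>j<n. star (x j) * x j) = real n *\<^sub>R vec_inner n x x"
        by (simp add: vec_inner_def sum_constant_scaleR del: sum_constant)
      have "(\<Sum>i<n. \<Sum>j<n. star (x j) * star (X i j) * x i)
          = (\<Sum>i<n. \<Sum>j<n. star (x j) * X j i * x i)"
        using herm by (intro sum.cong) auto
      also have "\<dots> = vec_inner n x (mat_vec n X x)"
        unfolding vec_inner_mat_vec by (rule sum.swap)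
      finally have 3: "(\<Sum>i<n. \<Sum>j<n. star (x j) * star (X i j) * x i) = vec_inner n x (mat_vec n X x)" .
      have "(\<Sum>i<n. \<Sum>j<n. ?g i j)
        = N *\<^sub>R ((\<Sum>i<n. \<Sum>j<n. star (x i) * x i) + (\<Sum>i<n. \<Sum>j<n. star (x j) * x j))
          - (vec_inner n x (mat_vec n X x) + (\<Sum>i<n. \<Sum>j<n. star (x j) * star (X i j) * x i))"
        unfolding vec_inner_mat_vec
        by (simp add: sum_subtractf sum.distrib scaleR_sum_right scaleR_add_right del: sum_constant)
      also have "\<dots> = 2 *\<^sub>R ((real n * N) *\<^sub>R vec_inner n x x - vec_inner n x (mat_vec n X x))"
        unfolding 1 2 3 scaleR_2 by (simp add: algebra_simps)
      finally show ?thesis .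
    qed
    ultimately have "pos (2 *\<^sub>R ((real n * N) *\<^sub>R vec_inner n x x - vec_inner n x (mat_vec n X x)))"
      by simp
    from pos_scaleR[OF this, of "1/2"]
    have "pos ((real n * N) *\<^sub>R vec_inner n x x - vec_inner n x (mat_vec n X x))" by simp
    from pos_add[OF this pos_vec_inner_self[of n x]] show ?thesis
      by (simp add: r_def algebra_simps)
  qed
  have bound: "norm (mat_power n T k i j) \<le> 1" if "i < n" "j < n" for k i j
  proof (rule norm_mat_power_le_one[where A = A])
    show "mat_vec n T x i \<in> A" if "\<And>j. j < n \<Longrightarrow> x j \<in> A" "i < n" for x i
      unfolding mat_vec_def using TA that by (intro sum_mem mult_mem) auto
    show "pos (vec_inner n x (mat_vec n T x))" for x
    proof -
      have "vec_inner n x (mat_vec n T x)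
          = (1/r) *\<^sub>R (r *\<^sub>R vec_inner n x x - vec_inner n x (mat_vec n X x))"
        unfolding inner_T using \<open>r > 0\<close> by (simp add: algebra_simps)
      then show ?thesis using X_le \<open>r > 0\<close> by (simp add: pos_scaleR)
    qed
    show "pos (vec_inner n x x - vec_inner n x (mat_vec n T x))" if "\<And>i. i < n \<Longrightarrow> x i \<in> A" for x
    proof -
      have "pos ((1/r) *\<^sub>R vec_inner n x (mat_vec n X x))"
        unfolding vec_inner_mat_vec using form[of x] that \<open>r > 0\<close> by (intro pos_scaleR) auto
      then show ?thesis by (simp add: inner_T)
    qed
  qed (use that hermT in auto)
  define Z where "Z i j = (\<Sum>k. sqrt_coeff k *\<^sub>R mat_power n T k i j)" for i j
  have sums: "summable (\<lambda>k. norm (sqrt_coeff k *\<^sub>R mat_power n T k i j))" if "i < n" "j < n" for i j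
    using sqrt_series(1)[of n "mat_power n T" Z] mat_power_add bound Z_def that by blast
  have prod: "(\<Sum>l<n. Z i l * Z l j) = mat_power n T 0 i j - mat_power n T 1 i j" if "i < n" "j < n" for i j
    using sqrt_series(2)[of n "mat_power n T" Z] mat_power_add bound Z_def that by blast
  have powA: "mat_power n T k i j \<in> A" if "i < n" "j < n" for k i j
    using that by (induction k arbitrary: i j) (auto intro!: sum_mem mult_mem TA)
  have ZA: "Z i j \<in> A" if "i < n" "j < n" for i j
    unfolding Z_def using summable_norm_cancel[OF sums] powA that by (intro suminf_mem) auto
  have hermZ: "star (Z i j) = Z j i" if "i < n" "j < n" for i j
    unfolding Z_def bounded_linear.suminf[OF bounded_linear_star summable_norm_cancel[OF sums[OF that]]]
    using hermT that by (simp add: star_scaleR star_mat_power)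
  show ?thesis
  proof (rule that[of "\<lambda>i j. sqrt r *\<^sub>R Z i j"])
    fix i j assume ij: "i < n" "j < n"
    show "sqrt r *\<^sub>R Z i j \<in> A" using ZA[OF ij] by auto
    have "(\<Sum>k<n. star (sqrt r *\<^sub>R Z k i) * (sqrt r *\<^sub>R Z k j)) = r *\<^sub>R (\<Sum>k<n. Z i k * Z k j)"
      using \<open>r > 0\<close> ij by (simp add: star_scaleR hermZ scaleR_sum_right)
    also have "\<dots> = X i j"
      unfolding prod[OF ij] using \<open>r > 0\<close> ij
      by (simp add: mat_power_1 T_def del: One_nat_def mat_power.simps(2))
    finally show "X i j = (\<Sum>k<n. star (sqrt r *\<^sub>R Z k i) * (sqrt r *\<^sub>R Z k j))" by simp
  qed
qed

section \<open>Injectivity and supports\<close>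

text \<open>The direct sum of two copies of the algebra, with carrier encoded in the type \<open>'u\<close>.\<close>

definition direct_square :: "('a::cstar_algebra \<times> 'a \<Rightarrow> 'u) \<Rightarrow> 'u cstar_struct" where
  "direct_square e = (let l = \<lambda>x. fst (inv_into UNIV e x); r = \<lambda>x. snd (inv_into UNIV e x) in
     \<lparr>carrier = range e, mult = \<lambda>x y. e (l x * l y, r x * r y), one = e (1, 1), zero = e (0, 0),
      add = \<lambda>x y. e (l x + l y, r x + r y), smult = \<lambda>c x. e (c *\<^sub>C l x, c *\<^sub>C r x),
      adj = \<lambda>x. e (star (l x), star (r x)), nrm = \<lambda>x. max (norm (l x)) (norm (r x))\<rparr>)"

lemma direct_square_simps:
  assumes "inj e"
  shows "carrier (direct_square e) = range e"
    "e (a, b) \<otimes>\<^bsub>direct_square e\<^esub> e (c, d) = e (a * c, b * d)"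
    "\<one>\<^bsub>direct_square e\<^esub> = e (1, 1)" "\<zero>\<^bsub>direct_square e\<^esub> = e (0, 0)"
    "e (a, b) \<oplus>\<^bsub>direct_square e\<^esub> e (c, d) = e (a + c, b + d)"
    "z \<odot>\<^bsub>direct_square e\<^esub> e (a, b) = e (z *\<^sub>C a, z *\<^sub>C b)"
    "adj (direct_square e) (e (a, b)) = e (star a, star b)"
    "nrm (direct_square e) (e (a, b)) = max (norm a) (norm b)"
  using assms by (simp_all add: direct_square_def Let_def)

lemma unital_cstar_algebra_direct_square:
  fixes e :: "'a::cstar_algebra \<times> 'a \<Rightarrow> 'u"
  assumes e: "inj e"
  shows "unital_cstar_algebra (direct_square e)"
proof -
  let ?B = "direct_square e"
  note s = direct_square_simps[OF e]
  have e_eq: "e p = e q \<longleftrightarrow> p = q" for p q using e by (auto dest: injD)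
  have ag: "abelian_group ?B"
  proof (rule abelian_groupI)
    fix x assume "x \<in> carrier ?B"
    then obtain a b where "x = e (a, b)" by (auto simp: s)
    then show "\<exists>y\<in>carrier ?B. y \<oplus>\<^bsub>?B\<^esub> x = \<zero>\<^bsub>?B\<^esub>"
      by (intro bexI[of _ "e (- a, - b)"]) (simp_all add: s)
  qed (auto simp: s algebra_simps)
  have mon: "Group.monoid ?B"
    by unfold_locales (auto simp: s algebra_simps)
  have ring: "ring ?B"
    by (rule ringI[OF ag mon]) (auto simp: s algebra_simps)
  have module: "module complex_ring ?B"
    by (rule moduleI[OF cring_complex_ring ag])
      (auto simp: s complex_ring_def scaleC_add_right scaleC_add_left scaleC_scaleC scaleC_one)
  interpret R: ring ?B by (rule ring)
  have minus: "e (a, b) \<ominus>\<^bsub>?B\<^esub> e (c, d) = e (a - c, b - d)" for a b c d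
  proof -
    have "\<ominus>\<^bsub>?B\<^esub> e (c, d) = e (- c, - d)"
      by (rule R.minus_equality) (simp_all add: s)
    then show ?thesis by (simp add: a_minus_def s)
  qed
  have complete: "\<exists>l\<in>carrier ?B. (\<lambda>n. nrm ?B (x n \<ominus>\<^bsub>?B\<^esub> l)) \<longlonglongrightarrow> 0"
    if x: "\<And>n::nat. x n \<in> carrier ?B"
      and C: "\<And>\<epsilon>. 0 < \<epsilon> \<Longrightarrow> \<exists>N. \<forall>m\<ge>N. \<forall>n\<ge>N. nrm ?B (x m \<ominus>\<^bsub>?B\<^esub> x n) < \<epsilon>" for x
  proof -
    define a b where "a n = fst (inv_into UNIV e (x n))" and "b n = snd (inv_into UNIV e (x n))" for n
    have xe: "x n = e (a n, b n)" for n
      using x[of n] by (simp add: a_def b_def s f_inv_into_f)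
    have "\<exists>N. \<forall>m\<ge>N. \<forall>n\<ge>N. dist (a m) (a n) < \<epsilon> \<and> dist (b m) (b n) < \<epsilon>" if "0 < \<epsilon>" for \<epsilon>
      using C[OF that] by (simp add: xe minus s dist_norm)
    then have "Cauchy a" "Cauchy b"
      unfolding Cauchy_def by blast+
    then obtain la lb where l: "a \<longlonglongrightarrow> la" "b \<longlonglongrightarrow> lb"
      using Cauchy_convergent convergentD by metis
    have "(\<lambda>n. max (norm (a n - la)) (norm (b n - lb))) \<longlonglongrightarrow> max 0 0"
      using l by (intro tendsto_max) (simp_all add: LIM_zero_iff tendsto_norm_zero_iff)
    then show ?thesis
      by (intro bexI[of _ "e (la, lb)"]) (simp_all add: xe minus s)
  qed
  show ?thesis
  proof (intro unital_cstar_algebra.intro ring module unital_cstar_algebra_axioms.intro)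
    fix x y assume "x \<in> carrier ?B" "y \<in> carrier ?B"
    then obtain a b c d where xy: "x = e (a, b)" "y = e (c, d)" by (auto simp: s)
    show "nrm ?B (x \<oplus>\<^bsub>?B\<^esub> y) \<le> nrm ?B x + nrm ?B y"
      unfolding xy s
      by (intro max.boundedI order_trans[OF norm_triangle_ineq] add_mono) auto
    show "nrm ?B (x \<otimes>\<^bsub>?B\<^esub> y) \<le> nrm ?B x * nrm ?B y"
      unfolding xy s
      by (intro max.boundedI order_trans[OF norm_mult_ineq] mult_mono) (auto simp: le_max_iff_disj)
  next
    fix x assume "x \<in> carrier ?B"
    then obtain a b where x: "x = e (a, b)" by (auto simp: s)
    show "nrm ?B (adj ?B x \<otimes>\<^bsub>?B\<^esub> x) = (nrm ?B x)\<^sup>2"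
      unfolding x s norm_star_mult by (auto simp: max_def power_mono_iff)
    show "nrm ?B x = 0 \<longleftrightarrow> x = \<zero>\<^bsub>?B\<^esub>"
      unfolding x s e_eq by (auto simp: max_def)
    show "nrm ?B (c \<odot>\<^bsub>?B\<^esub> x) = cmod c * nrm ?B x" for c
      unfolding x s norm_scaleC by (simp add: max_mult_distrib_left)
  qed (use complete in \<open>auto simp: s e_eq mult_scaleC_left mult_scaleC_right star_star star_add
      star_scaleC star_mult le_max_iff_disj\<close>)
qed

lemma finsum_direct_square:
  fixes n :: nat
  assumes "inj e"
  shows "(\<Oplus>\<^bsub>direct_square e\<^esub>k\<in>{..<n}. e (f k, g k)) = e (\<Sum>k<n. f k, \<Sum>k<n. g k)"
proof -
  interpret B: ring "direct_square e"
    using unital_cstar_algebra_direct_square[OF assms] by (rule unital_cstar_algebra.axioms(1))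
  show ?thesis
    by (induction n)
      (simp_all add: lessThan_Suc direct_square_simps[OF assms] Pi_def add.commute)
qed

lemma (in unital_subalgebra) finsum_cstar_on:
  fixes n :: nat
  assumes "\<And>k. k < n \<Longrightarrow> f k \<in> A"
  shows "(\<Oplus>\<^bsub>cstar_on A\<^esub>k\<in>{..<n}. f k) = (\<Sum>k<n. f k)"
proof -
  interpret B: ring "cstar_on A"
    using unital_cstar_algebra_cstar_on[OF subalgebra one_mem] by (rule unital_cstar_algebra.axioms(1))
  have c: "carrier (cstar_on A) = A" by (simp add: cstar_on_def)
  show ?thesis
    using assms
  proof (induction n)
    case 0
    show ?case by simp (simp add: cstar_on_def)
  next
    case (Suc n)
    then have "(\<Oplus>\<^bsub>cstar_on A\<^esub>k\<in>{..<Suc n}. f k) = f n \<oplus>\<^bsub>cstar_on A\<^esub> (\<Oplus>\<^bsub>cstar_on A\<^esub>k\<in>{..<n}. f k)"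
      unfolding lessThan_Suc by (intro B.finsum_insert) (auto simp: c)
    also have "\<dots> = f n + (\<Sum>k<n. f k)" using Suc by (simp add: cstar_on_def)
    finally show ?case by (simp add: add.commute)
  qed
qed

lemma (in unital_subalgebra) matrix_positive_cstar_on:
  "matrix_positive (cstar_on A) n X \<longleftrightarrow>
    (\<exists>Y. (\<forall>i<n. \<forall>j<n. Y i j \<in> A) \<and> (\<forall>i<n. \<forall>j<n. X i j = (\<Sum>k<n. star (Y k i) * Y k j)))"
proof -
  have "(\<Oplus>\<^bsub>cstar_on A\<^esub>k\<in>{..<n}. star (Y k i) * Y k j) = (\<Sum>k<n. star (Y k i) * Y k j)"
    if "\<forall>i<n. \<forall>j<n. Y i j \<in> A" "i < n" "j < n" for Y :: "nat \<Rightarrow> nat \<Rightarrow> 'a" and i j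
    using that by (intro finsum_cstar_on) auto
  moreover have c: "carrier (cstar_on A) = A" "adj (cstar_on A) = star" "monoid.mult (cstar_on A) = (*)"
    by (simp_all add: cstar_on_def)
  ultimately show ?thesis
    unfolding matrix_positive_def c
    by (intro arg_cong[where f = Ex] ext conj_cong refl) simp
qed

text \<open>Fits pairs into the test universe of \<open>injective_abelian\<close>. A pair becomes
  the function with weights 1 and 2 at its components, distinct so that their order is recoverable,
  and this function becomes its indicator.\<close>

lemma pair_encoding:
  obtains e :: "'a \<times> 'a \<Rightarrow> ('a \<Rightarrow> complex) \<Rightarrow> complex" where "inj e"
proof
  define F :: "'a \<times> 'a \<Rightarrow> 'a \<Rightarrow> complex" where
    "F p = (\<lambda>z. (if z = fst p then 1 else 0) + (if z = snd p then 2 else 0))" for p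
  have F: "p = q" if "F p = F q" for p q
  proof -
    have "F q (fst p) = F p (fst p)" "F q (snd p) = F p (snd p)" using that by simp_all
    then show ?thesis by (auto simp: F_def prod_eq_iff split: if_splits)
  qed
  show "inj (\<lambda>p f. if f = F p then 1 else 0 :: complex)"
  proof (rule injI)
    fix p q assume "(\<lambda>f. if f = F p then 1 else 0 :: complex) = (\<lambda>f. if f = F q then 1 else 0)"
    from fun_cong[OF this, of "F p"] show "p = q" using F by (auto split: if_splits)
  qed
qed

section \<open>Annihilator ideals and the splitting map\<close>

context abelian_subalgebra
begin

definition annihilator :: "'a set \<Rightarrow> 'a set" where
  "annihilator W = {z \<in> A. \<forall>w\<in>W. z * w = 0}"

lemma annihilator_mult: "z \<in> annihilator W \<Longrightarrow> a \<in> A \<Longrightarrow> a * z \<in> annihilator W"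
  by (auto simp: annihilator_def mult.assoc)

lemma annihilator_star:
  assumes "W \<subseteq> A" "z \<in> annihilator W"
  shows "star z \<in> annihilator W"
proof -
  have "star z * w = 0" if "w \<in> W" for w
  proof (rule eq_zero_of_star_mult)
    have z: "z \<in> A" "w \<in> A" "z * w = 0" using assms that by (auto simp: annihilator_def)
    have "star (star z * w) * (star z * w) = star w * (z * star z) * w"
      by (simp add: star_simps mult.assoc)
    also have "z * star z = star z * z" using z by (intro commute) auto
    also have "star w * (star z * z) * w = 0" using z(3) by (simp add: mult.assoc)
    finally show "star (star z * w) * (star z * w) = 0" .
  qed
  then show ?thesis using assms by (auto simp: annihilator_def)
qed

lemma annihilator_subset: "annihilator W \<subseteq> A"
  by (auto simp: annihilator_def)

lemma annihilator_annihilator_annihilator: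
  assumes "W \<subseteq> A"
  shows "annihilator (annihilator (annihilator W)) = annihilator W"
proof -
  have sub: "S \<subseteq> annihilator (annihilator S)" if "S \<subseteq> A" for S
  proof
    fix s assume s: "s \<in> S"
    have "s * z = 0" if "z \<in> annihilator S" for z
      using commute[of s z] s that \<open>S \<subseteq> A\<close> by (auto simp: annihilator_def)
    then show "s \<in> annihilator (annihilator S)"
      using s \<open>S \<subseteq> A\<close> by (auto simp: annihilator_def[of "annihilator S"])
  qed
  have "annihilator (annihilator (annihilator W)) \<subseteq> annihilator W"
    using sub[OF assms] by (auto simp: annihilator_def)
  then show ?thesis using sub[OF annihilator_subset[of W]] by blast
qed

lemma annihilator_add: "x \<in> annihilator W \<Longrightarrow> y \<in> annihilator W \<Longrightarrow> x + y \<in> annihilator W"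
  and annihilator_diff: "x \<in> annihilator W \<Longrightarrow> y \<in> annihilator W \<Longrightarrow> x - y \<in> annihilator W"
  and annihilator_scaleC: "x \<in> annihilator W \<Longrightarrow> c *\<^sub>C x \<in> annihilator W"
  and annihilator_zero: "0 \<in> annihilator W"
  by (auto simp: annihilator_def algebra_simps mult_scaleC_left)

lemma annihilator_sum: "(\<And>i. i \<in> S \<Longrightarrow> f i \<in> annihilator W) \<Longrightarrow> sum f S \<in> annihilator W"
  by (induction S rule: infinite_finite_induct) (auto intro: annihilator_add annihilator_zero)

lemma annihilator_inter:
  assumes "W \<subseteq> A" "z \<in> annihilator W" "z \<in> annihilator (annihilator W)"
  shows "z = 0"
proof (rule eq_zero_of_mult_star)
  show "z * star z = 0"
    using annihilator_star[OF assms(1,2)] assms(3)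
    unfolding annihilator_def[of "annihilator W"] by blast
qed


text \<open>As \<open>I\<close> and \<open>J\<close> meet in 0, nothing is lost by passing to the
  two quotients. The negative part \<open>b\<close> of \<delta> is killed by \<open>J\<close> and by
  \<open>I\<close>, hence belongs to both.\<close>

lemma pos_of_pos_mod_annihilators:
  assumes W: "W \<subseteq> A" and J: "J = annihilator W" and I: "I = annihilator J"
    and mem: "\<alpha> \<in> A" "\<beta> \<in> A" "\<delta> \<in> A" and p: "pos \<alpha>" "pos \<beta>"
    and d: "\<alpha> - \<delta> \<in> I" "\<beta> - \<delta> \<in> J"
  shows "pos \<delta>"
proof -
  have JA: "J \<subseteq> A" and IA: "I \<subseteq> A" using J I annihilator_subset by auto
  have annI: "annihilator I = J" using annihilator_annihilator_annihilator[OF W] I J by simp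
  have "star (\<alpha> - \<delta>) \<in> I" using annihilator_star[OF JA, folded I] d by simp
  from annihilator_diff[of _ J, folded I, OF this d(1)] have 1: "\<delta> - star \<delta> \<in> I"
    by (simp add: star_diff pos_star p)
  have "star (\<beta> - \<delta>) \<in> J" using annihilator_star[OF W, folded J] d by simp
  from annihilator_diff[of _ W, folded J, OF this d(2)] have 2: "\<delta> - star \<delta> \<in> J"
    by (simp add: star_diff pos_star p)
  have "\<delta> - star \<delta> = 0"
    using annihilator_inter[OF W, of "\<delta> - star \<delta>"] 1 2 unfolding I J by blast
  then have "star \<delta> = \<delta>" by simp
  then obtain a b where ab: "a \<in> A" "b \<in> A" "pos a" "pos b" "\<delta> = a - b" "a * b = 0"
    using pos_parts[OF mem(3)] by metis
  \<comment> \<open>If \<gamma> and \<delta> agree on z, then |z|^2 b \<gamma> b is positive and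
    equals - |z|^2 b^3, so both vanish.\<close>
  have key: "b * z = 0" if z: "z \<in> A" and \<gamma>: "\<gamma> \<in> A" "pos \<gamma>" "(\<gamma> - \<delta>) * z = 0" for \<gamma> z
  proof -
    have "z * \<gamma> = z * \<delta>" using \<gamma>(3) z \<gamma>(1) mem(3) by (simp add: left_diff_distrib commute)
    then have "star z * z * (b * \<gamma> * b) = star z * z * (b * \<delta> * b)"
      using z ab \<gamma>(1) mem(3) commute by (metis (no_types, lifting) mult.assoc)
    also have "b * \<delta> * b = (b * a) * b - b * b * b"
      unfolding ab(5) by (simp add: algebra_simps)
    also have "b * a = 0" using ab commute by simp
    finally have "- (star z * z * (b * b * b)) = star z * z * (b * \<gamma> * b)" by simp
    moreover have "pos (star z * z * (b * \<gamma> * b))"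
      using z ab \<gamma> by (intro pos_mult pos_star_mult) auto
    moreover have "pos (star z * z * (b * b * b))"
      using z ab by (intro pos_mult pos_star_mult) auto
    ultimately have "star z * z * (b * b * b) = 0"
      using pos_antisym by metis
    then have "star (z * (b * b)) * (z * (b * b)) = 0"
      using z ab commute by (simp add: star_mult pos_star) (metis (no_types, lifting) mult.assoc mult_zero_right mult_mem star_mem)
    then have "z * (b * b) = 0" by (rule eq_zero_of_star_mult)
    then have "star (b * star z) * (b * star z) = 0"
      using ab by (simp add: star_simps pos_star mult.assoc) (metis mult.assoc mult_zero_left)
    then have "b * star z = 0" by (rule eq_zero_of_star_mult)
    then have "star (b * star z) = 0" by simp
    then show ?thesis using ab z by (simp add: star_simps pos_star commute)
  qed
  have "b * z = 0" if "z \<in> J" for z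
    using key[of z \<alpha>] that d(1) mem p JA by (auto simp: I annihilator_def)
  then have "b \<in> I" using ab by (auto simp: I annihilator_def)
  moreover have "b * z = 0" if "z \<in> I" for z
    using key[of z \<beta>] that d(2) mem p IA by (auto simp: annihilator_def simp flip: annI)
  then have "b \<in> annihilator I" using ab by (auto simp: annihilator_def)
  ultimately have "b \<in> J" "b \<in> annihilator J" by (simp_all add: annI flip: I)
  then have "b = 0" using annihilator_inter[OF W, of b] by (simp flip: J)
  then show ?thesis using ab by simp
qed

text \<open>For functions in \<open>A\<close>: take the first component off the closed support of
  \<open>W\<close> and the second one on it. Hence P (0, 1) is the natural candidate for the support
  projection.\<close>

definition splitting_map :: "'a set \<Rightarrow> ('a \<times> 'a \<Rightarrow> 'a) \<Rightarrow> bool" where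
  "splitting_map W P \<longleftrightarrow> (\<forall>p. P p \<in> A) \<and>
    (\<forall>a b c d. P (a + c, b + d) = P (a, b) + P (c, d)) \<and>
    (\<forall>z a b. P (z *\<^sub>C a, z *\<^sub>C b) = z *\<^sub>C P (a, b)) \<and>
    (\<forall>a b. \<exists>y\<in>A. P (star a * a, star b * b) = star y * y) \<and>
    (\<forall>d\<in>A. P (d, d) = d) \<and>
    (\<forall>j\<in>annihilator W. P (j, 0) = j) \<and>
    (\<forall>i\<in>annihilator (annihilator W). P (0, i) = i)"

text \<open>\<open>A\<close> embeds into the quotient of \<open>A \<oplus> A\<close> by \<open>I \<oplus> J\<close>, where \<open>J\<close> is the annihilator of \<open>W\<close> and
  \<open>I\<close> that of \<open>J\<close>. The preimage \<open>S\<close> of \<open>A\<close> is an operator system in the direct square, and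
  injectivity extends the resulting map \<open>\<phi>\<close> from \<open>S\<close> to \<open>A\<close>.\<close>

lemma splitting_map_exists:
  assumes inj: "injective_abelian A" and W: "W \<subseteq> A"
  shows "\<exists>P. splitting_map W P"
proof -
  define J where J: "J = annihilator W"
  define I where I: "I = annihilator J"
  obtain e :: "'a \<times> 'a \<Rightarrow> ('a \<Rightarrow> complex) \<Rightarrow> complex" where e: "inj e"
    by (rule pair_encoding)
  note s = direct_square_simps[OF e]
  let ?B = "direct_square e"
  note cstarB = unital_cstar_algebra_direct_square[OF e]
  interpret B: ring ?B using cstarB by (rule unital_cstar_algebra.axioms(1))
  have JA: "J \<subseteq> A" and IA: "I \<subseteq> A" using J I annihilator_subset by auto
  \<comment> \<open>(a, b) is congruent to the diagonal element (d, d) modulo \<open>I\<close> and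
    \<open>J\<close>; \<open>d\<close> is unique because the ideals meet in 0.\<close>
  define R where "R a b d \<longleftrightarrow> a \<in> A \<and> b \<in> A \<and> d \<in> A \<and> a - d \<in> I \<and> b - d \<in> J" for a b d
  have R_unique: "d = d'" if "R a b d" "R a b d'" for a b d d'
  proof -
    have "d' - d \<in> I" "d' - d \<in> J"
      using that annihilator_diff[of "a - d" J "a - d'"] annihilator_diff[of "b - d" W "b - d'"]
      by (auto simp: R_def I J)
    then show ?thesis using annihilator_inter[OF W, of "d' - d"] by (simp add: I J)
  qed
  have R_refl: "R d d d" if "d \<in> A" for d
    using that by (simp add: R_def I J annihilator_zero)
  have R_add: "R (a + a') (b + b') (d + d')" if "R a b d" "R a' b' d'" for a b d a' b' d'
    using that annihilator_add[of "a - d" J "a' - d'"] annihilator_add[of "b - d" W "b' - d'"]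
    by (auto simp: R_def I J algebra_simps)
  have R_scaleC: "R (z *\<^sub>C a) (z *\<^sub>C b) (z *\<^sub>C d)" if "R a b d" for z a b d
    using that annihilator_scaleC[of "a - d" J z] annihilator_scaleC[of "b - d" W z]
    by (auto simp: R_def I J complex_vector.scale_right_diff_distrib)
  have R_star: "R (star a) (star b) (star d)" if "R a b d" for a b d
    using that annihilator_star[OF JA, of "a - d"] annihilator_star[OF W, of "b - d"]
    by (auto simp: R_def I J star_diff)
  have R_mult: "R (c * a) (c * b) (c * d)" if "R a b d" "c \<in> A" for a b c d
    using that annihilator_mult[of "a - d" J c] annihilator_mult[of "b - d" W c]
    by (auto simp: R_def I J right_diff_distrib)
  have R_sum: "R (\<Sum>i\<in>S. a i) (\<Sum>i\<in>S. b i) (\<Sum>i\<in>S. d i)" if "\<And>i. i \<in> S \<Longrightarrow> R (a i) (b i) (d i)"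
    for S :: "nat set" and a b d
    using that by (induction S rule: infinite_finite_induct) (auto intro: R_add R_refl)
  define S where "S = {e (a, b) | a b d. R a b d}"
  define \<phi> where "\<phi> x = (THE d. R (fst (inv_into UNIV e x)) (snd (inv_into UNIV e x)) d)" for x
  have \<phi>: "\<phi> (e (a, b)) = d" if "R a b d" for a b d
    unfolding \<phi>_def using that R_unique e by (intro the_equality) auto
  have R_\<phi>: "R a b (\<phi> (e (a, b)))" if "e (a, b) \<in> S" for a b
    using that \<phi> e by (auto simp: S_def dest: injD)
  have S: "e (a, b) \<in> S" if "R a b d" for a b d using that by (auto simp: S_def)
  have opsys: "operator_system ?B S"
    unfolding operator_system_def
  proof (intro conjI ballI allI)
    show "S \<subseteq> carrier ?B" by (auto simp: S_def s)
    show "\<one>\<^bsub>?B\<^esub> \<in> S" using S[OF R_refl] by (simp add: s)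
    fix x assume "x \<in> S"
    then obtain a b d where x: "x = e (a, b)" "R a b d" by (auto simp: S_def)
    show "z \<odot>\<^bsub>?B\<^esub> x \<in> S" for z unfolding x s using S[OF R_scaleC[OF x(2)]] .
    show "adj ?B x \<in> S" unfolding x s using S[OF R_star[OF x(2)]] .
    fix y assume "y \<in> S"
    then obtain a' b' d' where y: "y = e (a', b')" "R a' b' d'" by (auto simp: S_def)
    show "x \<oplus>\<^bsub>?B\<^esub> y \<in> S" unfolding x y s using S[OF R_add[OF x(2) y(2)]] .
  qed
  have cp: "completely_positive ?B S (cstar_on A) \<phi>"
    unfolding completely_positive_def
  proof (intro conjI ballI allI impI)
    fix x assume "x \<in> S"
    then obtain a b d where x: "x = e (a, b)" "R a b d" by (auto simp: S_def)
    show "\<phi> x \<in> carrier (cstar_on A)" using x \<phi> by (auto simp: cstar_on_def R_def)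
    show "\<phi> (z \<odot>\<^bsub>?B\<^esub> x) = z \<odot>\<^bsub>cstar_on A\<^esub> \<phi> x" for z
      using \<phi>[OF x(2)] \<phi>[OF R_scaleC[OF x(2)]] by (simp add: x s cstar_on_def)
    fix y assume "y \<in> S"
    then obtain a' b' d' where y: "y = e (a', b')" "R a' b' d'" by (auto simp: S_def)
    show "\<phi> (x \<oplus>\<^bsub>?B\<^esub> y) = \<phi> x \<oplus>\<^bsub>cstar_on A\<^esub> \<phi> y"
      using \<phi>[OF x(2)] \<phi>[OF y(2)] \<phi>[OF R_add[OF x(2) y(2)]] by (simp add: x y s cstar_on_def)
  next
    fix n X assume "(\<forall>i<n. \<forall>j<n. X i j \<in> S) \<and> matrix_positive ?B n X"
    then obtain Y where "\<forall>i<n. \<forall>j<n. X i j \<in> S" "\<forall>i<n. \<forall>j<n. Y i j \<in> range e"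
      "\<forall>i<n. \<forall>j<n. X i j = (\<Oplus>\<^bsub>?B\<^esub>k\<in>{..<n}. adj ?B (Y k i) \<otimes>\<^bsub>?B\<^esub> Y k j)"
      unfolding matrix_positive_def s(1) by blast
    then have X: "\<And>i j. i < n \<Longrightarrow> j < n \<Longrightarrow> X i j \<in> S"
      and Y: "\<And>i j. i < n \<Longrightarrow> j < n \<Longrightarrow> Y i j \<in> range e"
      and XY: "\<And>i j. i < n \<Longrightarrow> j < n \<Longrightarrow> X i j = (\<Oplus>\<^bsub>?B\<^esub>k\<in>{..<n}. adj ?B (Y k i) \<otimes>\<^bsub>?B\<^esub> Y k j)"
      by blast+
    define f g where "f i j = fst (inv_into UNIV e (Y i j))" and "g i j = snd (inv_into UNIV e (Y i j))" for i j
    have Ye: "Y i j = e (f i j, g i j)" if "i < n" "j < n" for i j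
      using Y[OF that] by (simp add: f_def g_def f_inv_into_f)
    define a b where "a i j = (\<Sum>k<n. star (f k i) * f k j)" and "b i j = (\<Sum>k<n. star (g k i) * g k j)" for i j
    have Xe: "X i j = e (a i j, b i j)" if "i < n" "j < n" for i j
    proof -
      have "X i j = (\<Oplus>\<^bsub>?B\<^esub>k\<in>{..<n}. e (star (f k i) * f k j, star (g k i) * g k j))"
        unfolding XY[OF that] by (intro B.finsum_cong') (auto simp: Ye that s)
      then show ?thesis by (simp add: finsum_direct_square[OF e] a_def b_def)
    qed
    define d where "d i j = \<phi> (X i j)" for i j
    have R: "R (a i j) (b i j) (d i j)" if "i < n" "j < n" for i j
      using R_\<phi> X[OF that] by (simp add: d_def Xe[OF that])
    have form_a: "pos (\<Sum>i<n. \<Sum>j<n. star (x i) * (\<Sum>k<n. star (h k i) * h k j) * x j)"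
      for x :: "nat \<Rightarrow> 'a" and h
    proof -
      have "(\<Sum>i<n. \<Sum>j<n. star (x i) * (\<Sum>k<n. star (h k i) * h k j) * x j)
          = (\<Sum>i<n. \<Sum>k<n. \<Sum>j<n. star (h k i * x i) * (h k j * x j))"
        unfolding sum_distrib_left sum_distrib_right
        by (subst (2) sum.swap) (simp add: star_mult mult.assoc)
      also have "\<dots> = (\<Sum>k<n. star (\<Sum>i<n. h k i * x i) * (\<Sum>j<n. h k j * x j))"
        by (subst sum.swap) (simp add: star_sum sum_product)
      finally show ?thesis by (simp add: pos_sum pos_star_mult)
    qed
    obtain Z where Z: "\<And>i j. i < n \<Longrightarrow> j < n \<Longrightarrow> Z i j \<in> A"
      "\<And>i j. i < n \<Longrightarrow> j < n \<Longrightarrow> d i j = (\<Sum>k<n. star (Z k i) * Z k j)"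
    proof (rule matrix_factorization[of n d])
      show "d i j \<in> A" if "i < n" "j < n" for i j using R[OF that] by (simp add: R_def)
      show "star (d i j) = d j i" if "i < n" "j < n" for i j
      proof -
        have "star (a i j) = a j i" "star (b i j) = b j i"
          by (simp_all add: a_def b_def star_sum star_simps)
        then show ?thesis using R_star[OF R[OF that]] R[OF that(2,1)] R_unique by simp
      qed
      \<comment> \<open>The forms of \<open>a\<close> and \<open>b\<close> are sums of squares and
        congruent to the form of \<open>d\<close>; commutativity lets the coefficients from
        \<open>A\<close> be gathered on one side.\<close>
      show "pos (\<Sum>i<n. \<Sum>j<n. star (x i) * d i j * x j)" if x: "\<And>i. i < n \<Longrightarrow> x i \<in> A" for x
      proof -
        have "R (\<Sum>i<n. \<Sum>j<n. star (x i) * a i j * x j) (\<Sum>i<n. \<Sum>j<n. star (x i) * b i j * x j)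
          (\<Sum>i<n. \<Sum>j<n. star (x i) * d i j * x j)"
        proof (intro R_sum)
          fix i j assume "i \<in> {..<n}" "j \<in> {..<n}"
          then have ij: "i < n" "j < n" by auto
          have "R (star (x i) * x j * a i j) (star (x i) * x j * b i j) (star (x i) * x j * d i j)"
            using x ij R[OF ij] by (intro R_mult) auto
          moreover have "star (x i) * x j * c = star (x i) * c * x j" if "c \<in> A" for c
            using commute[OF x[OF ij(2)] that] by (simp add: mult.assoc)
          ultimately show "R (star (x i) * a i j * x j) (star (x i) * b i j * x j) (star (x i) * d i j * x j)"
            using R[OF ij] by (simp add: R_def)
        qed
        moreover have "pos (\<Sum>i<n. \<Sum>j<n. star (x i) * a i j * x j)"
          "pos (\<Sum>i<n. \<Sum>j<n. star (x i) * b i j * x j)"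
          unfolding a_def b_def by (rule form_a)+
        ultimately show ?thesis
          using pos_of_pos_mod_annihilators[OF W J I] unfolding R_def by blast
      qed
    qed blast
    then show "matrix_positive (cstar_on A) n (\<lambda>i j. \<phi> (X i j))"
      unfolding matrix_positive_cstar_on d_def by blast
  qed
  obtain \<psi> where \<psi>: "completely_positive ?B (range e) (cstar_on A) \<psi>" "\<And>x. x \<in> S \<Longrightarrow> \<psi> x = \<phi> x"
    using inj cstarB opsys cp
    unfolding injective_abelian_def injective_in_def by (metis s(1))
  have c: "carrier (cstar_on A) = A" "add (cstar_on A) = (+)" "smult (cstar_on A) = scaleC"
    by (simp_all add: cstar_on_def)
  note cpd = \<psi>(1)[unfolded completely_positive_def c]
  have on_S: "\<psi> (e (a, b)) = d" if "R a b d" for a b d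
    using \<psi>(2)[of "e (a, b)"] \<phi>[OF that] that by (auto simp: S_def)
  have "splitting_map W (\<lambda>p. \<psi> (e p))"
    unfolding splitting_map_def J[symmetric] I[symmetric]
  proof (intro conjI allI ballI)
    show "\<psi> (e p) \<in> A" for p using cpd by blast
    show "\<psi> (e (a + c, b + d)) = \<psi> (e (a, b)) + \<psi> (e (c, d))" for a b c d
      using cpd s(5)[of a b c d] by (metis rangeI)
    show "\<psi> (e (z *\<^sub>C a, z *\<^sub>C b)) = z *\<^sub>C \<psi> (e (a, b))" for z a b
      using cpd s(6)[of z a b] by (metis rangeI)
    show "\<psi> (e (d, d)) = d" if "d \<in> A" for d
      using on_S[OF R_refl[OF that]] .
    show "\<psi> (e (j, 0)) = j" if "j \<in> J" for j
    proof (rule on_S)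
      have "0 - j \<in> J" using that annihilator_scaleC[of j W "-1"]
        by (simp add: J scaleC_uminus scaleC_one)
      then show "R j 0 j" using that JA by (auto simp: R_def I annihilator_zero)
    qed
    show "\<psi> (e (0, i)) = i" if "i \<in> I" for i
    proof (rule on_S)
      have "0 - i \<in> I" using that annihilator_scaleC[of i J "-1"]
        by (simp add: I scaleC_uminus scaleC_one)
      then show "R 0 i i" using that IA by (auto simp: R_def J annihilator_zero)
    qed
    show "\<exists>y\<in>A. \<psi> (e (star a * a, star b * b)) = star y * y" for a b
    proof -
      let ?x = "e (star a * a, star b * b)"
      have "(\<Oplus>\<^bsub>?B\<^esub>k\<in>{..<1::nat}. adj ?B (e (a, b)) \<otimes>\<^bsub>?B\<^esub> e (a, b)) = ?x"
        using finsum_direct_square[OF e, of "\<lambda>k. star a * a" "\<lambda>k. star b * b" 1] by (simp add: s)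
      then have "matrix_positive ?B 1 (\<lambda>i j. ?x)"
        unfolding matrix_positive_def by (intro exI[of _ "\<lambda>i j. e (a, b)"]) (simp add: s)
      then have "matrix_positive (cstar_on A) 1 (\<lambda>i j. \<psi> ?x)"
        using cpd[THEN conjunct2, THEN conjunct2, THEN conjunct2, rule_format, of 1 "\<lambda>i j. ?x"] by simp
      then show ?thesis unfolding matrix_positive_cstar_on by auto
    qed
  qed
  then show ?thesis by blast
qed

end

section \<open>Support projections and the projection onto the subalgebra\<close>

context abelian_subalgebra
begin

text \<open>If \<open>1 - f\<close> dominates the positive contractions of an ideal, it dominates the approximate
  unit \<open>1 - (1 - c)\<^sup>n\<close> attached to such a contraction \<open>c\<close>; so \<open>0 \<le> f c \<le> (1 - c)\<^sup>n c \<le> 1 / (n + 1)\<close>.\<close>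

lemma annihilates_of_dominates:
  assumes I: "I = annihilator J" and f: "f \<in> A" "pos f"
    and dom: "\<And>k. k \<in> I \<Longrightarrow> pos k \<Longrightarrow> pos (1 - k) \<Longrightarrow> pos (1 - f - k)" and i: "i \<in> I"
  shows "f * i = 0"
proof -
  have IA: "I \<subseteq> A" using I annihilator_subset by simp
  have contr: "f * c = 0" if c: "c \<in> I" "pos c" "pos (1 - c)" for c
  proof -
    have cA: "c \<in> A" using c IA by blast
    define g where "g n = (1 - c) ^ n" for n
    have g: "g n \<in> A" for n using cA by (auto simp: g_def)
    have gpos: "pos (g n)" for n
    proof (induction n)
      case (Suc n)
      have "pos ((1 - c) * g n)" using Suc c cA g by (intro pos_mult) auto
      then show ?case by (simp add: g_def)
    qed (simp add: g_def)
    have g_Suc: "g (Suc n) = g n - g n * c" for n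
      using commute[OF g[of n] cA] by (simp add: g_def algebra_simps)
    have tele: "(\<Sum>m<n. g m * c) = 1 - g n" for n
      by (induction n) (simp_all add: g_Suc, simp add: g_def)
    have gc: "pos (g m * c)" for m using gpos c g cA by (intro pos_mult) auto
    have k: "1 - g n \<in> I" "pos (1 - g n)" for n
      unfolding tele[symmetric] using gc annihilator_mult[of c J] c(1) g
      by (auto intro!: pos_sum annihilator_sum simp: I)
    have decr: "pos (g m - g n)" if "m \<le> n" for m n
    proof -
      have "g m - g n = g m * (1 - g (n - m))"
        using that by (simp add: g_def right_diff_distrib flip: power_add)
      then show ?thesis using gpos k g by (auto intro!: pos_mult)
    qed
    have fc: "pos (f * c)" using f c cA by (intro pos_mult) auto
    have "norm (f * c) \<le> 1 / real (Suc n)" for n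
    proof -
      have "pos (1 - f - (1 - g n))" using dom[of "1 - g n"] k gpos by simp
      then have "pos ((1 - f - (1 - g n)) * c)"
        using c cA f g by (intro pos_mult) auto
      then have "norm (f * c) \<le> norm (g n * c)"
        using fc by (intro norm_mono_pos) (auto simp: algebra_simps)
      \<comment> \<open>The terms g m c with m at most n telescope to 1 - g (n + 1), and each of
        these n + 1 terms dominates g n c.\<close>
      moreover have "norm (real (Suc n) *\<^sub>R (g n * c)) \<le> norm (1::'a)"
      proof (rule norm_mono_pos)
        show "pos (real (Suc n) *\<^sub>R (g n * c))" using gc by (intro pos_scaleR) auto
        have "pos (g (Suc n) + (\<Sum>m<Suc n. (g m - g n) * c))"
          using gpos decr c cA g by (intro pos_add pos_sum pos_mult) auto
        moreover have "(\<Sum>m<Suc n. (g m - g n) * c) = 1 - g (Suc n) - real (Suc n) *\<^sub>R (g n * c)"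
          unfolding left_diff_distrib sum_subtractf tele
          by (simp add: sum_constant_scaleR del: sum_constant sum.lessThan_Suc of_nat_Suc)
        ultimately show "pos (1 - real (Suc n) *\<^sub>R (g n * c))" by simp
      qed
      then have "real (Suc n) * norm (g n * c) \<le> 1"
        by (simp only: norm_scaleR norm_one abs_of_nat)
      then have "norm (g n * c) \<le> 1 / real (Suc n)"
        by (simp add: pos_le_divide_eq mult.commute del: of_nat_Suc)
      ultimately show ?thesis by (rule order_trans)
    qed
    then have "norm (f * c) \<le> e" if "0 < e" for e
      using nat_approx_posE[OF that] by (metis less_imp_le order_trans)
    then have "norm (f * c) \<le> 0" using field_le_epsilon[of "norm (f * c)" 0] by simp
    then show ?thesis by simp
  qed
  show ?thesis
  proof (cases "i = 0")
    case False
    \<comment> \<open>Reduction to a positive contraction in the ideal: f c = 0 makes i f vanish,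
      since |i f|^2 = f |i|^2 f.\<close>
    define c where "c = (1 / (norm i)\<^sup>2) *\<^sub>R (star i * i)"
    have iA: "i \<in> A" using i IA by blast
    have "c = (star ((1 / (norm i)\<^sup>2) *\<^sub>R i)) * i" by (simp add: c_def star_scaleR)
    moreover have "star ((1 / (norm i)\<^sup>2) *\<^sub>R i) \<in> A" using iA by blast
    ultimately have "c \<in> I" using annihilator_mult[of i J] i by (simp add: I)
    moreover have "pos c" unfolding c_def by (intro pos_scaleR pos_star_mult) simp
    moreover have "norm c = 1" using False by (simp add: c_def norm_star_mult)
    then have "pos (1 - c)" using pos_of_real_diff[of c 1] pos_star[OF \<open>pos c\<close>] by simp
    ultimately have "f * c = 0" by (rule contr)
    then have "f * (star i * i) = 0" using False by (simp add: c_def)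
    then have "star (i * f) * (i * f) = 0"
      by (simp add: star_mult pos_star[OF f(2)] flip: mult.assoc)
    then have "i * f = 0" by (rule eq_zero_of_star_mult)
    then show ?thesis using commute[OF f(1) iA] by simp
  qed simp
qed

text \<open>P (1, 0) and P (0, 1) add up to 1. Applying P to (0, 1 - k) shows that 1 - f dominates
  the positive contractions k of \<open>I\<close>, so \<open>f\<close> kills \<open>I\<close>;
  symmetrically \<open>h\<close> kills \<open>J\<close>, which contains \<open>f\<close>. Thus h f =
  0, so \<open>h\<close> is a projection.\<close>

lemma support_exists:
  assumes inj: "injective_abelian A" and W: "W \<subseteq> A"
  obtains e where "e \<in> A" "star e = e" "e * e = e" "\<And>w. w \<in> W \<Longrightarrow> e * w = w"
    "\<And>z. z \<in> A \<Longrightarrow> (\<And>w. w \<in> W \<Longrightarrow> z * w = 0) \<Longrightarrow> z * e = 0"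
proof -
  define J where "J = annihilator W"
  define I where "I = annihilator J"
  have annI: "J = annihilator I"
    using annihilator_annihilator_annihilator[OF W] by (simp add: I_def J_def)
  obtain P where "splitting_map W P" using splitting_map_exists[OF inj W] by blast
  then have P: "\<And>p. P p \<in> A"
    "\<And>a b c d. P (a + c, b + d) = P (a, b) + P (c, d)"
    "\<And>z a b. P (z *\<^sub>C a, z *\<^sub>C b) = z *\<^sub>C P (a, b)"
    "\<And>a b. \<exists>y\<in>A. P (star a * a, star b * b) = star y * y"
    "\<And>d. d \<in> A \<Longrightarrow> P (d, d) = d" "\<And>j. j \<in> J \<Longrightarrow> P (j, 0) = j" "\<And>i. i \<in> I \<Longrightarrow> P (0, i) = i"
    unfolding splitting_map_def I_def J_def by blast+
  have P_pos: "pos (P (a, b))" if ab: "pos a" "pos b" for a b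
  proof -
    obtain s where "pos s" "s * s = a"
      using unital_subalgebra.pos_sqrt[OF unital_subalgebra_UNIV ab(1)] by auto
    moreover obtain t where "pos t" "t * t = b"
      using unital_subalgebra.pos_sqrt[OF unital_subalgebra_UNIV ab(2)] by auto
    ultimately show ?thesis using P(4)[of s t] by (auto simp: pos_star pos_star_mult)
  qed
  define f h where "f = P (1, 0)" and "h = P (0, 1)"
  have fh: "f \<in> A" "h \<in> A" "pos f" "pos h" using P P_pos by (simp_all add: f_def h_def)
  have h: "h = 1 - f" using P(2)[of 1 0 0 1] P(5)[of 1] by (simp add: f_def h_def eq_diff_eq add.commute)
  have fI: "f * i = 0" if "i \<in> I" for i
  proof (rule annihilates_of_dominates[OF I_def fh(1,3) _ that])
    fix k assume k: "k \<in> I" "pos k" "pos (1 - k)"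
    have "P (0, 1 - k) = 1 - f - k" using P(2)[of 0 0 "1 - k" k] P(7)[OF k(1)] h h_def by (simp add: eq_diff_eq)
    then show "pos (1 - f - k)" using P_pos[OF pos_zero k(3)] by simp
  qed
  have hJ: "h * j = 0" if "j \<in> J" for j
  proof (rule annihilates_of_dominates[OF annI fh(2,4) _ that])
    fix k assume k: "k \<in> J" "pos k" "pos (1 - k)"
    have "P (1 - k, 0) = 1 - h - k" using P(2)[of "1 - k" k 0 0] P(6)[OF k(1)] h f_def by (simp add: eq_diff_eq add.commute)
    then show "pos (1 - h - k)" using P_pos[OF k(3) pos_zero] by simp
  qed
  have "f \<in> J" using fI fh by (auto simp: annI annihilator_def[of I])
  have "h * h = h"
    using hJ[OF \<open>f \<in> J\<close>] by (simp add: h algebra_simps)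
  show ?thesis
  proof (rule that[of h])
    show "h * w = w" if "w \<in> W" for w
    proof -
      have "w * j = 0" if "j \<in> J" for j
        using that \<open>w \<in> W\<close> W commute[of w j] by (auto simp: J_def annihilator_def)
      then have "w \<in> I" using that W by (auto simp: I_def annihilator_def[of J])
      then show ?thesis using fI by (simp add: h left_diff_distrib)
    qed
    show "z * h = 0" if "z \<in> A" "\<And>w. w \<in> W \<Longrightarrow> z * w = 0" for z
      using hJ[of z] that commute[OF that(1) fh(2)] by (simp add: J_def annihilator_def)
  qed (use fh \<open>h * h = h\<close> pos_star in auto)
qed

text \<open>Positivity asks for a root y inside \<open>A\<close> because states on \<open>A\<close>
  are tested on \<open>star y * y\<close> with y in \<open>A\<close>.\<close>

definition conditional_expectation :: "('a \<Rightarrow> 'a) \<Rightarrow> bool" where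
  "conditional_expectation E \<longleftrightarrow> (\<forall>x. E x \<in> A) \<and> (\<forall>x y. E (x + y) = E x + E y) \<and>
    (\<forall>c x. E (c *\<^sub>C x) = c *\<^sub>C E x) \<and> (\<forall>x. \<exists>y\<in>A. E (star x * x) = star y * y) \<and>
    (\<forall>d\<in>A. E d = d)"

text \<open>Restricted to the diagonal of \<C>, every splitting map is a positive projection onto
  \<open>A\<close>; W = {} is one choice.\<close>

lemma expectation_exists:
  assumes inj: "injective_abelian A"
  shows "\<exists>E. conditional_expectation E"
proof -
  obtain P where "splitting_map {} P" using splitting_map_exists[OF inj, of "{}"] by blast
  then have P: "\<And>p. P p \<in> A"
    "\<And>a b c d. P (a + c, b + d) = P (a, b) + P (c, d)"
    "\<And>z a b. P (z *\<^sub>C a, z *\<^sub>C b) = z *\<^sub>C P (a, b)"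
    "\<And>a b. \<exists>y\<in>A. P (star a * a, star b * b) = star y * y"
    "\<And>d. d \<in> A \<Longrightarrow> P (d, d) = d"
    unfolding splitting_map_def by blast+
  have "conditional_expectation (\<lambda>x. P (x, x))"
    unfolding conditional_expectation_def using P by blast
  then show ?thesis by blast
qed

text \<open>Binary expansion: with \<open>p\<close> the support of \<open>(h - 1/2)\<^sub>+\<close> one has \<open>0 \<le> h - p/2 \<le> 1/2\<close>.\<close>

lemma binary_digit_exists:
  assumes inj: "injective_abelian A" and h: "h \<in> A" "pos h" "pos (1 - h)"
  obtains p where "p \<in> A" "star p = p" "p * p = p" "pos (2 *\<^sub>R h - p)" "pos (1 - (2 *\<^sub>R h - p))"
proof -
  define k where "k = h - (1/2) *\<^sub>R 1"
  have "k \<in> A" "star k = k" using h by (auto simp: k_def star_simps pos_star)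
  then obtain a b where ab: "a \<in> A" "b \<in> A" "pos a" "pos b" "k = a - b" "a * b = 0"
    by (rule pos_parts)
  obtain p where p: "p \<in> A" "star p = p" "p * p = p" "p * a = a" "b * p = 0"
  proof -
    obtain p where "p \<in> A" "star p = p" "p * p = p" "\<And>w. w \<in> {a} \<Longrightarrow> p * w = w"
      "\<And>z. z \<in> A \<Longrightarrow> (\<And>w. w \<in> {a} \<Longrightarrow> z * w = 0) \<Longrightarrow> z * p = 0"
      using support_exists[OF inj, of "{a}"] ab by auto
    then show ?thesis using that[of p] ab commute by simp
  qed
  have hk: "h = (1/2) *\<^sub>R 1 + a - b" using ab(5) by (simp add: k_def algebra_simps)
  have "p * b = 0" using p(1,5) ab(2) commute by simp
  then have ph: "p * h = (1/2) *\<^sub>R p + a" unfolding hk by (simp add: algebra_simps p(4))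
  have pp: "pos p" "pos (1 - p)"
    using pos_square[of p] pos_square[of "1 - p"] p(2,3) by (simp_all add: star_simps algebra_simps)
  \<comment> \<open>Both bounds become twice a sum of positive terms, the products having commuting
    factors.\<close>
  have "pos (2 *\<^sub>R (a + (1 - p) * h))" "pos (2 *\<^sub>R (p * (1 - h) + b))"
    using ab pp p h by (auto intro!: pos_scaleR pos_add pos_mult)
  moreover have "2 *\<^sub>R (a + (1 - p) * h) = 2 *\<^sub>R h - p"
    unfolding left_diff_distrib ph by (simp add: algebra_simps)
  moreover have "2 *\<^sub>R (p * (1 - h) + b) = 1 - (2 *\<^sub>R h - p)"
    unfolding right_diff_distrib ph unfolding hk
    by (simp add: scaleR_right_distrib scaleR_right_diff_distrib) (simp add: scaleR_2)
  ultimately show ?thesis using that p by metis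
qed

text \<open>Passing from h to 2h - p doubles the commutator with \<open>x\<close> but stays between
  0 and 1, where commutators are bounded by 2 norm x. After n binary digits the commutator of h is
  at most that bound divided by 2^n.\<close>

lemma commutant_of_commutes_projections:
  assumes inj: "injective_abelian A"
    and x: "\<And>p. p \<in> A \<Longrightarrow> star p = p \<Longrightarrow> p * p = p \<Longrightarrow> x * p = p * x"
  shows "x \<in> commutant A"
proof -
  have bound: "norm (x * h - h * x) \<le> 2 * norm x / 2 ^ n" if "h \<in> A" "pos h" "pos (1 - h)" for h n
    using that
  proof (induction n arbitrary: h)
    case 0
    have "norm h \<le> 1" using norm_mono_pos[OF 0(2,3)] by simp
    then have "norm (x * h) \<le> norm x" "norm (h * x) \<le> norm x"
      using norm_mult_ineq[of x h] norm_mult_ineq[of h x]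
      by (meson mult_left_le mult_left_le_one_le norm_ge_zero order_trans)+
    then show ?case using norm_triangle_ineq4[of "x * h" "h * x"] by simp
  next
    case (Suc n)
    obtain p where p: "p \<in> A" "star p = p" "p * p = p" "pos (2 *\<^sub>R h - p)" "pos (1 - (2 *\<^sub>R h - p))"
      using binary_digit_exists[OF inj Suc.prems] .
    define k where "k = 2 *\<^sub>R h - p"
    have "norm (x * k - k * x) \<le> 2 * norm x / 2 ^ n"
      using Suc.IH[of k] p Suc.prems by (auto simp: k_def)
    moreover have "x * k - k * x = 2 *\<^sub>R (x * h - h * x)"
      using x[OF p(1-3)] by (simp add: k_def algebra_simps)
    ultimately show ?case by simp
  qed
  have unit: "x * h = h * x" if h: "h \<in> A" "pos h" "pos (1 - h)" for h
  proof -
    have "(\<lambda>n. 2 * norm x / 2 ^ n) \<longlonglongrightarrow> 0"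
      using LIMSEQ_divide_realpow_zero[of 2 "2 * norm x"] by simp
    then have "norm (x * h - h * x) \<le> 0"
      using bound[OF h] by (intro tendsto_lowerbound[of _ 0 sequentially]) auto
    then show ?thesis by simp
  qed
  have sa: "x * h = h * x" if h: "h \<in> A" "star h = h" for h
  proof -
    define t where "t = norm h + 1"
    have t: "t > 0" "norm h \<le> t" by (simp_all add: t_def add_nonneg_pos)
    define k where "k = (1 / (2 * t)) *\<^sub>R (t *\<^sub>R 1 + h)"
    have "1 - k = (1 / (2 * t)) *\<^sub>R (t *\<^sub>R 1 - h)"
      using t by (simp add: k_def algebra_simps) (simp add: field_simps flip: scaleR_add_left)
    then have "pos k" "pos (1 - k)"
      using pos_of_real_add[OF h(2) t(2)] pos_of_real_diff[OF h(2) t(2)] t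
      by (simp_all add: k_def pos_scaleR)
    moreover have "k \<in> A" using h by (auto simp: k_def simp del: scaleR_right_distrib)
    ultimately have "x * k = k * x" by (intro unit)
    then have "(2 * t) *\<^sub>R (x * k) = (2 * t) *\<^sub>R (k * x)" by simp
    then show ?thesis using t by (simp add: k_def algebra_simps)
  qed
  have "x * y = y * x" if "y \<in> A" for y
  proof -
    obtain h k where hk: "star h = h" "star k = k" "y = h + \<i> *\<^sub>C k"
      "h = (1/2) *\<^sub>R (y + star y)" "k = (1/2) *\<^sub>R (\<i> *\<^sub>C (star y - y))"
      by (rule cartesian_decomposition)
    have "h \<in> A" "k \<in> A" unfolding hk(4,5) using that by blast+
    then have "x * h = h * x" "x * k = k * x" using sa hk(1,2) by auto
    then show ?thesis unfolding hk(3)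
      by (simp add: distrib_left distrib_right mult_scaleC_left mult_scaleC_right)
  qed
  then show ?thesis by (simp add: commutant_def)
qed

end

section \<open>The fixed part of a normalizer\<close>

text \<open>Frolik's argument: a maximal subset \<open>W\<close> of \<open>D\<close> that \<open>v\<close> moves off itself has a support
  projection \<open>e\<close> with the same property, and \<open>v\<close> acts trivially on what is disjoint from \<open>e\<close> and
  from its translates by \<open>v\<close> and \<open>v\<^sup>*\<close>.\<close>

lemma normalizer_fixed_part:
  assumes masa: "masa_inclusion D" and inj: "injective_abelian D" and v: "v \<in> normalizers D"
  obtains e where "e \<in> D" "star e = e" "e * e = e" "e * v * e = 0"
    "\<And>k. k \<in> D \<Longrightarrow> k * e = 0 \<Longrightarrow> k * v * e = 0 \<Longrightarrow> e * v * k = 0 \<Longrightarrow> k * v * k \<in> D"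
proof -
  interpret abelian_subalgebra D
    using masa by (simp add: masa_inclusion_def inclusion_iff)
  have vd: "star v * d * v \<in> D" "v * d * star v \<in> D" if "d \<in> D" for d
    using v that by (auto simp: normalizers_def)
  define \<W> where "\<W> = {W. W \<subseteq> D \<and> (\<forall>i\<in>W. \<forall>j\<in>W. i * v * j = 0)}"
  have "\<exists>W\<in>\<W>. \<forall>X\<in>\<W>. W \<subseteq> X \<longrightarrow> X = W"
  proof (rule subset_Zorn')
    fix C assume C: "subset.chain \<W> C"
    have "i * v * j = 0" if ij: "i \<in> X" "j \<in> Y" and XY: "X \<in> C" "Y \<in> C" for i j X Y
    proof -
      have "X \<subseteq> Y \<or> Y \<subseteq> X" "X \<in> \<W>" "Y \<in> \<W>" using C XY by (auto simp: subset_chain_def)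
      then show ?thesis using ij unfolding \<W>_def by blast
    qed
    then show "\<Union>C \<in> \<W>" using C by (fastforce simp: \<W>_def subset_chain_def)
  qed
  then obtain W where W: "W \<in> \<W>" "\<And>X. X \<in> \<W> \<Longrightarrow> W \<subseteq> X \<Longrightarrow> X = W" by blast
  have WD: "W \<subseteq> D" and Wv: "\<And>i j. i \<in> W \<Longrightarrow> j \<in> W \<Longrightarrow> i * v * j = 0"
    using W(1) by (auto simp: \<W>_def)
  obtain e where e: "e \<in> D" "star e = e" "e * e = e" "\<And>w. w \<in> W \<Longrightarrow> e * w = w"
    "\<And>z. z \<in> D \<Longrightarrow> (\<And>w. w \<in> W \<Longrightarrow> z * w = 0) \<Longrightarrow> z * e = 0"
    using support_exists[OF inj WD] by blast
  have we: "w * e = w" if "w \<in> W" for w using e(4)[OF that] commute[OF e(1)] that WD by auto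
  \<comment> \<open>The support property concerns elements of \<open>D\<close>. So v j is replaced
    by v j \<open>star j\<close> \<open>star v\<close>, which is in \<open>D\<close> as v is a
    normalizer and kills \<open>W\<close>, hence also e.\<close>
  have evj: "e * v * j = 0" if j: "j \<in> W" for j
  proof -
    have jD: "j \<in> D" using j WD by blast
    have d: "v * (j * star j) * star v \<in> D" using jD by (intro vd mult_mem star_mem)
    have "v * (j * star j) * star v * w = 0" if "w \<in> W" for w
    proof -
      have "w * (v * (j * star j) * star v) = (w * v * j) * star j * star v" by (simp add: mult.assoc)
      also have "\<dots> = 0" using Wv[OF that j] by simp
      finally show ?thesis using commute[OF _ d, of w] that WD by auto
    qed
    then have "v * (j * star j) * star v * e = 0" by (rule e(5)[OF d])
    then have "(e * v * j) * star (e * v * j) = 0"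
      by (simp add: star_mult e(2) mult.assoc)
    then show ?thesis by (rule eq_zero_of_mult_star)
  qed
  have eve: "e * v * e = 0"
  proof -
    have "star v * e * v * w = 0" if "w \<in> W" for w
      using evj[OF that] by (simp add: mult.assoc)
    then have 1: "star v * e * v * e = 0" using vd e(1) by (intro e(5)) auto
    have "star (e * v * e) * (e * v * e) = e * (star v * (e * e) * v * e)"
      by (simp add: star_mult e(2) mult.assoc)
    also have "\<dots> = 0" unfolding e(3) 1 by simp
    finally show ?thesis by (rule eq_zero_of_star_mult)
  qed
  \<comment> \<open>The element u built below lives where v carries part of c into b, and v moves it
    off itself. It can join \<open>W\<close>, so by maximality it is already there; then u = u e =
    0, and b v c vanishes with it.\<close>
  have disjoint: "b * v * c = 0"
    if b: "b \<in> D" and c: "c \<in> D" "c * e = 0" "c * v * e = 0" "e * v * c = 0" and bc: "b * c = 0" for b c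
  proof -
    define g where "g = star v * (star b * b) * v"
    have g: "g \<in> D" unfolding g_def using b by (intro vd mult_mem star_mem)
    define u where "u = g * c"
    have u: "u \<in> D" "u = c * g" using g c(1) commute[OF g c(1)] by (auto simp: u_def)
    have vv: "v * star v \<in> D" using vd(2)[of 1] by simp
    \<comment> \<open>Moving c past v \<open>star v\<close>, an element of \<open>D\<close>, brings
      it next to b.\<close>
    have "u * v * u = g * (c * (v * star v)) * (star b * b) * v * c"
      unfolding u_def g_def by (simp add: mult.assoc)
    also have "c * (v * star v) = (v * star v) * c" using c(1) vv by (rule commute)
    also have "g * ((v * star v) * c) * (star b * b) * v * c
        = g * (v * star v) * (c * star b * b) * v * c"
      by (simp add: mult.assoc)
    also have "c * star b * b = star b * (b * c)"
      using c(1) b commute by (metis mult.assoc star_mem)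
    finally have uu: "u * v * u = 0" using bc by simp
    have uj: "u * v * j = 0" "j * v * u = 0" if "j \<in> W" for j
    proof -
      have "u * v * j = g * (c * v * e) * j" by (simp add: u_def mult.assoc e(4)[OF that])
      then show "u * v * j = 0" using c(3) by simp
      have "j * v * u = j * (e * v * c) * g" by (simp add: u(2) mult.assoc) (simp add: we[OF that] flip: mult.assoc)
      then show "j * v * u = 0" using c(4) by simp
    qed
    have "insert u W \<in> \<W>" using u(1) uu uj Wv WD by (auto simp: \<W>_def)
    then have "u \<in> W" using W(2) by blast
    then have "u = u * e" by (simp add: we)
    also have "u * e = g * (c * e)" by (simp add: u_def mult.assoc)
    finally have "u = 0" using c(2) by simp
    then have "star v * (star b * b) * v * c = 0" by (simp add: u_def g_def)
    then have "star (b * v * c) * (b * v * c) = 0"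
      by (simp add: star_mult mult.assoc)
    then show ?thesis by (rule eq_zero_of_star_mult)
  qed
  have "k * v * k \<in> D" if k: "k \<in> D" "k * e = 0" "k * v * e = 0" "e * v * k = 0" for k
  proof -
    \<comment> \<open>With q = 1 - p and the roles exchanged, this is commutation with the
      projection p.\<close>
    have half: "p * (k * v * k) * q = 0" if pq: "p \<in> D" "q \<in> D" "p * q = 0" for p q
    proof -
      have kq: "k * q = q * k" using k(1) pq(2) by (rule commute)
      have "p * k * v * (k * q) = 0"
      proof (rule disjoint)
        show "k * q * e = 0" unfolding kq using k(2) by (simp add: mult.assoc)
        show "k * q * v * e = 0" unfolding kq using k(3) by (simp add: mult.assoc)
        show "e * v * (k * q) = 0" using k(4) by (simp flip: mult.assoc)
        have "p * k * (k * q) = k * k * (p * q)"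
          using commute[OF pq(1) k(1)] by (metis mult.assoc)
        then show "p * k * (k * q) = 0" using pq(3) by simp
      qed (use k pq in auto)
      then show ?thesis by (simp add: mult.assoc)
    qed
    have "k * v * k \<in> commutant D"
    proof (rule commutant_of_commutes_projections[OF inj])
      fix p assume p: "p \<in> D" "star p = p" "p * p = p"
      have "p * (k * v * k) * (1 - p) = 0" "(1 - p) * (k * v * k) * p = 0"
        using p by (intro half; auto simp: algebra_simps)+
      then have "p * (k * v * k) = p * (k * v * k) * p" "k * v * k * p = p * (k * v * k) * p"
        by (simp_all only: right_diff_distrib left_diff_distrib mult_1_right mult_1_left
            right_minus_eq)
      then show "k * v * k * p = p * (k * v * k)" by simp
    qed
    then show ?thesis using masa by (rule masa_commutant[rotated])
  qed
  then show ?thesis using that e(1-3) eve by blast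
qed

section \<open>States\<close>

context unital_subalgebra
begin

context
  fixes f
  assumes f: "state_on A f"
begin

lemma state_add: "x \<in> A \<Longrightarrow> y \<in> A \<Longrightarrow> f (x + y) = f x + f y"
  and state_scaleC: "x \<in> A \<Longrightarrow> f (c *\<^sub>C x) = c * f x"
  and state_star_mult: "x \<in> A \<Longrightarrow> f (star x * x) \<in> \<real>\<^sub>\<ge>\<^sub>0"
  and state_one: "f 1 = 1"
  using f by (auto simp: state_on_def)

lemma state_scaleR: "x \<in> A \<Longrightarrow> f (r *\<^sub>R x) = of_real r * f x"
  using state_scaleC[of x "of_real r"] by (simp add: scaleC_of_real)

lemma state_diff: "x \<in> A \<Longrightarrow> y \<in> A \<Longrightarrow> f (x - y) = f x - f y"
  using state_add[of x "- y"] state_scaleR[of y "-1"] by auto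

lemma state_pos: "a \<in> A \<Longrightarrow> pos a \<Longrightarrow> f a \<in> \<real>\<^sub>\<ge>\<^sub>0"
  using pos_sqrt state_star_mult by (metis pos_star)

lemma state_self_adjoint:
  assumes "h \<in> A" "star h = h"
  shows "f h \<in> \<real>" "\<bar>Re (f h)\<bar> \<le> norm h"
proof -
  have "f (norm h *\<^sub>R 1 + h) \<in> \<real>\<^sub>\<ge>\<^sub>0" "f (norm h *\<^sub>R 1 - h) \<in> \<real>\<^sub>\<ge>\<^sub>0"
    using assms pos_of_real_add[OF assms(2) order_refl] pos_of_real_diff[OF assms(2) order_refl]
    by (auto intro!: state_pos)
  moreover have "f (norm h *\<^sub>R 1 + h) = of_real (norm h) + f h"
    "f (norm h *\<^sub>R 1 - h) = of_real (norm h) - f h"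
    using assms(1) by (simp_all add: state_add state_diff state_scaleR state_one scaleR_mem)
  ultimately show "f h \<in> \<real>" "\<bar>Re (f h)\<bar> \<le> norm h"
    by (auto simp: complex_nonneg_Reals_iff complex_is_Real_iff)
qed

text \<open>The factor 2 comes from estimating the self-adjoint components separately; any constant
  allows passing from a span to its closure.\<close>

lemma state_norm_le:
  assumes "x \<in> A"
  shows "cmod (f x) \<le> 2 * norm x"
proof -
  obtain h k where hk: "star h = h" "star k = k" "x = h + \<i> *\<^sub>C k"
    "h = (1/2) *\<^sub>R (x + star x)" "k = (1/2) *\<^sub>R (\<i> *\<^sub>C (star x - x))"
    by (rule cartesian_decomposition)
  have A: "h \<in> A" "k \<in> A" unfolding hk(4,5) using assms by blast+
  have "norm h \<le> norm x" "norm k \<le> norm x"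
    unfolding hk(4,5) using norm_triangle_ineq[of x "star x"] norm_triangle_ineq4[of "star x" x]
    by (simp_all add: norm_star norm_scaleC)
  moreover have "cmod (f h) \<le> norm h" "cmod (f k) \<le> norm k"
    using state_self_adjoint[OF A(1) hk(1)] state_self_adjoint[OF A(2) hk(2)]
    by (auto simp: complex_is_Real_iff cmod_eq_Re)
  moreover have "f x = f h + \<i> * f k" unfolding hk(3) using A by (simp add: state_add state_scaleC scaleC_mem)
  then have "cmod (f x) \<le> cmod (f h) + cmod (f k)"
    using norm_triangle_ineq[of "f h" "\<i> * f k"] by (simp add: norm_mult)
  ultimately show ?thesis by linarith
qed

lemma state_star:
  assumes "x \<in> A"
  shows "f (star x) = cnj (f x)"
proof -
  obtain h k where hk: "star h = h" "star k = k" "x = h + \<i> *\<^sub>C k"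
    "h = (1/2) *\<^sub>R (x + star x)" "k = (1/2) *\<^sub>R (\<i> *\<^sub>C (star x - x))"
    by (rule cartesian_decomposition)
  have A: "h \<in> A" "k \<in> A" unfolding hk(4,5) using assms by blast+
  have "f (star x) = f h + (- \<i>) * f k"
    unfolding hk(3) star_add star_scaleC hk(1,2) using A by (simp add: state_diff state_scaleC scaleC_mem)
  moreover have "f x = f h + \<i> * f k" unfolding hk(3) using A by (simp add: state_add state_scaleC scaleC_mem)
  moreover have "cnj (f h) = f h" "cnj (f k) = f k"
    using state_self_adjoint(1)[OF A(1) hk(1)] state_self_adjoint(1)[OF A(2) hk(2)]
    by (simp_all add: Reals_cnj_iff)
  ultimately show ?thesis by simp
qed

text \<open>The degenerate case of Cauchy-Schwarz. Positivity at y - t \<alpha> x has no quadratic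
  term in t and reads 2 t |\<alpha>|^2 \<le> m for all real t.\<close>

lemma state_star_mult_eq_zero:
  assumes "x \<in> A" "y \<in> A" "f (star x * x) = 0"
  shows "f (star x * y) = 0"
proof -
  define \<alpha> where "\<alpha> = f (star x * y)"
  have conj: "f (star y * x) = cnj \<alpha>"
    using state_star[of "star x * y"] assms by (auto simp: \<alpha>_def star_mult star_star)
  define m where "m = Re (f (star y * y))"
  have bound: "2 * t * (cmod \<alpha>)\<^sup>2 \<le> m" for t
  proof -
    define c where "c = - (of_real t * \<alpha>)"
    have "star (y + c *\<^sub>C x) * (y + c *\<^sub>C x)
        = star y * y + c *\<^sub>C (star y * x) + cnj c *\<^sub>C (star x * y) + (cnj c * c) *\<^sub>C (star x * x)"
      by (simp add: star_add star_scaleC distrib_left distrib_right mult_scaleC_left mult_scaleC_right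
          scaleC_scaleC complex_vector.scale_right_distrib)
    then have "f (star (y + c *\<^sub>C x) * (y + c *\<^sub>C x)) = f (star y * y) + c * cnj \<alpha> + cnj c * \<alpha>"
      using assms by (simp add: state_add state_scaleC conj \<alpha>_def[symmetric] mult_mem add_mem star_mem scaleC_mem)
    moreover have "c * cnj \<alpha> + cnj c * \<alpha> = of_real (- (2 * t * (cmod \<alpha>)\<^sup>2))"
      using complex_norm_square[of \<alpha>] by (simp add: c_def algebra_simps)
    moreover have "f (star (y + c *\<^sub>C x) * (y + c *\<^sub>C x)) \<in> \<real>\<^sub>\<ge>\<^sub>0"
      using assms by (intro state_star_mult) auto
    ultimately have "0 \<le> Re (f (star y * y) + of_real (- (2 * t * (cmod \<alpha>)\<^sup>2)))"
      by (simp add: complex_nonneg_Reals_iff add.assoc)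
    then show ?thesis by (simp add: m_def)
  qed
  have "cmod \<alpha> = 0"
  proof (rule ccontr)
    assume "cmod \<alpha> \<noteq> 0"
    then have "2 * ((m + 1) / (2 * (cmod \<alpha>)\<^sup>2)) * (cmod \<alpha>)\<^sup>2 = m + 1" by simp
    then show False using bound[of "(m + 1) / (2 * (cmod \<alpha>)\<^sup>2)"] by simp
  qed
  then show ?thesis by (simp add: \<alpha>_def)
qed

end

end

text \<open>\<rho> is the convex combination, with weights r and 1 - r, of the normalized states x
  |-> \<rho> (a x) / r and x |-> \<rho> ((1 - a) x) / (1 - r). Extremality identifies them with
  \<rho>.\<close>

lemma (in abelian_subalgebra) pure_state_mult_contraction:
  assumes \<rho>: "pure_state_on A \<rho>" and a: "a \<in> A" "pos a" "pos (1 - a)"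
    and r: "\<rho> a = of_real r" "0 < r" "r < 1" and x: "x \<in> A"
  shows "\<rho> (a * x) = \<rho> a * \<rho> x"
proof -
  have st: "state_on A \<rho>" using \<rho> by (simp add: pure_state_on_def)
  note simps = state_add[OF st] state_scaleC[OF st] state_diff[OF st] state_one[OF st]
  have g: "state_on A (\<lambda>x. \<rho> (b * x) / of_real q)"
    if b: "b \<in> A" "pos b" and q: "\<rho> b = of_real q" "0 < q" for b q
  proof -
    obtain s where s: "s \<in> A" "pos s" "s * s = b" by (rule pos_sqrt[OF b(2,1)])
    have "\<rho> (b * (star y * y)) / of_real q \<in> \<real>\<^sub>\<ge>\<^sub>0" if "y \<in> A" for y
    proof -
      have "b * (star y * y) = star (s * y) * (s * y)"
        unfolding s(3)[symmetric] using commute[OF s(1) star_mem[OF that]]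
        by (simp add: star_mult pos_star[OF s(2)]) (metis mult.assoc)
      then have "\<rho> (b * (star y * y)) \<in> \<real>\<^sub>\<ge>\<^sub>0"
        using state_star_mult[OF st, of "s * y"] s that by auto
      then show ?thesis using q(2) by (auto simp: complex_nonneg_Reals_iff)
    qed
    then show ?thesis
      using b q unfolding state_on_def
      by (auto simp: simps distrib_left add_divide_distrib mult_scaleC_right mult_mem)
  qed
  have 1: "\<rho> (1 - a) = of_real (1 - r)" using a r by (simp add: simps)
  have "\<rho> y = of_real r * (\<rho> (a * y) / of_real r) + of_real (1 - r) * (\<rho> ((1 - a) * y) / of_real (1 - r))"
    if "y \<in> A" for y
    using r that a by (simp add: left_diff_distrib simps mult_mem flip: of_real_diff del: of_real_diff)
  moreover have "state_on A (\<lambda>x. \<rho> (a * x) / of_real r)" using g[OF a(1,2) r(1,2)] .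
  moreover have "state_on A (\<lambda>x. \<rho> ((1 - a) * x) / of_real (1 - r))"
    using g[OF _ a(3) 1] a(1) r(3) by auto
  ultimately have "\<forall>x\<in>A. \<rho> (a * x) / of_real r = \<rho> x"
    using \<rho> r(2,3) unfolding pure_state_on_def by blast
  then have "\<rho> (a * x) / of_real r = \<rho> x" using x by blast
  then show ?thesis using r by (simp add: field_simps)
qed

lemma (in abelian_subalgebra) pure_state_mult:
  assumes \<rho>: "pure_state_on A \<rho>" and xy: "x \<in> A" "y \<in> A"
  shows "\<rho> (x * y) = \<rho> x * \<rho> y"
proof -
  have st: "state_on A \<rho>" using \<rho> by (simp add: pure_state_on_def)
  note simps = state_add[OF st] state_scaleC[OF st] state_scaleR[OF st] state_diff[OF st] state_one[OF st]
  have sa: "\<rho> (h * y) = \<rho> h * \<rho> y" if h: "h \<in> A" "star h = h" for h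
  proof -
    \<comment> \<open>A strict bound on \<open>norm h\<close>, so that \<rho> maps the rescaled
      element \<open>a\<close> strictly between 0 and 1.\<close>
    define t where "t = 2 * norm h + 1"
    have t: "0 < t" "norm h < t" "2 * norm h \<le> t" by (simp_all add: t_def add_nonneg_pos)
    define a where "a = (1 / (2 * t)) *\<^sub>R (t *\<^sub>R 1 + h)"
    have "1 - a = (1 / (2 * t)) *\<^sub>R (t *\<^sub>R 1 - h)"
      using t by (simp add: a_def algebra_simps) (simp add: field_simps flip: scaleR_add_left)
    then have p: "pos a" "pos (1 - a)"
      using pos_of_real_add[OF h(2), of t] pos_of_real_diff[OF h(2), of t] t
      by (simp_all add: a_def pos_scaleR)
    have aA: "a \<in> A" using h by (auto simp: a_def simp del: scaleR_right_distrib)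
    obtain s where s: "\<rho> h = of_real s" using state_self_adjoint(1)[OF st h] by (auto elim: Reals_cases)
    then have "\<bar>s\<bar> < t" using state_self_adjoint(2)[OF st h] t by simp
    define r where "r = (t + s) / (2 * t)"
    have r: "\<rho> a = of_real r" using h t by (simp add: a_def r_def simps s scaleR_mem add_mem field_simps del: scaleR_right_distrib)
    have "0 < r" "r < 1" using \<open>\<bar>s\<bar> < t\<close> t by (auto simp: r_def field_simps)
    then have "\<rho> (a * y) = \<rho> a * \<rho> y"
      using pure_state_mult_contraction[OF \<rho> aA p r] xy by blast
    moreover have "h = (2 * t) *\<^sub>R a - t *\<^sub>R 1" using t by (simp add: a_def)
    ultimately show ?thesis using xy aA
      by (simp add: left_diff_distrib simps mult_mem scaleR_mem del: of_real_mult)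
  qed
  obtain h k where hk: "star h = h" "star k = k" "x = h + \<i> *\<^sub>C k"
    "h = (1/2) *\<^sub>R (x + star x)" "k = (1/2) *\<^sub>R (\<i> *\<^sub>C (star x - x))"
    by (rule cartesian_decomposition)
  have A: "h \<in> A" "k \<in> A" unfolding hk(4,5) using xy by blast+
  then show ?thesis
    unfolding hk(3) using sa[OF A(1) hk(1)] sa[OF A(2) hk(2)] xy
    by (simp add: distrib_right mult_scaleC_left simps mult_mem scaleC_mem)
qed

text \<open>Multiplicativity of \<rho> gives \<sigma> the value 0 on |z|^2 for \<open>star z\<close>
  = d - \<rho> d, so \<sigma> kills \<open>star z * x\<close> for all x. Adjoints give the other
  side.\<close>

lemma (in abelian_subalgebra) state_extension_module:
  assumes \<rho>: "pure_state_on A \<rho>" and \<sigma>: "state_on UNIV \<sigma>" "\<And>d. d \<in> A \<Longrightarrow> \<sigma> d = \<rho> d" and d: "d \<in> A"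
  shows "\<sigma> (d * x) = \<rho> d * \<sigma> x" "\<sigma> (x * d) = \<rho> d * \<sigma> x"
proof -
  have st: "state_on A \<rho>" using \<rho> by (simp add: pure_state_on_def)
  interpret U: unital_subalgebra "UNIV :: 'a set" by (rule unital_subalgebra_UNIV)
  note simps = U.state_add[OF \<sigma>(1)] U.state_scaleC[OF \<sigma>(1)] U.state_diff[OF \<sigma>(1)]
  have left: "\<sigma> (d * x) = \<rho> d * \<sigma> x" if "d \<in> A" for d x
  proof -
    define z where "z = star (d - \<rho> d *\<^sub>C 1)"
    have z: "z \<in> A" "star z = d - \<rho> d *\<^sub>C 1" using that by (auto simp: z_def star_star)
    have "\<rho> (star z) = 0" using that unfolding z(2)
      by (simp add: state_diff[OF st] state_scaleC[OF st] state_one[OF st] scaleC_mem)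
    then have "\<rho> (star z * z) = 0" using pure_state_mult[OF \<rho>, of "star z" z] z(1) by auto
    then have "\<sigma> (star z * z) = 0" using \<sigma>(2)[of "star z * z"] z(1) by auto
    then have "\<sigma> (star z * x) = 0" by (rule U.state_star_mult_eq_zero[OF \<sigma>(1) UNIV_I UNIV_I])
    then show ?thesis unfolding z(2) by (simp add: left_diff_distrib mult_scaleC_left simps)
  qed
  show "\<sigma> (d * x) = \<rho> d * \<sigma> x" using d by (rule left)
  have "\<sigma> (star (star d * star x)) = cnj (\<sigma> (star d * star x))" by (rule U.state_star[OF \<sigma>(1)]) simp
  also have "\<dots> = cnj (\<rho> (star d) * \<sigma> (star x))" using d by (simp add: left star_mem)
  also have "\<dots> = \<rho> d * \<sigma> x" using d by (simp add: state_star[OF st] U.state_star[OF \<sigma>(1)])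
  finally show "\<sigma> (x * d) = \<rho> d * \<sigma> x" by (simp add: star_mult star_star)
qed

text \<open>The point \<rho> is off e, because e v e = 0 while \<sigma> (e v e) = (\<rho> e)^2
  \<sigma> v. As v fixes it, it is off the translates of e as well, and k is made to vanish on all
  three.\<close>

lemma state_extension_value_on_normalizer:
  assumes masa: "masa_inclusion D" and inj: "injective_abelian D" and v: "v \<in> normalizers D"
    and \<rho>: "pure_state_on D \<rho>" and \<sigma>: "state_on UNIV \<sigma>" "\<And>d. d \<in> D \<Longrightarrow> \<sigma> d = \<rho> d"
    and nz: "\<sigma> v \<noteq> 0"
  obtains k where "k \<in> D" "\<rho> k \<noteq> 0" "k * v * k \<in> D"
proof -
  interpret abelian_subalgebra D
    using masa by (simp add: masa_inclusion_def inclusion_iff)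
  interpret U: unital_subalgebra "UNIV :: 'a set" by (rule unital_subalgebra_UNIV)
  have st: "state_on D \<rho>" using \<rho> by (simp add: pure_state_on_def)
  have module: "\<sigma> (d * x) = \<rho> d * \<sigma> x" "\<sigma> (x * d) = \<rho> d * \<sigma> x" if "d \<in> D" for d x
    using state_extension_module[OF \<rho> \<sigma>] that by auto
  have vd: "star v * d * v \<in> D" "v * d * star v \<in> D" if "d \<in> D" for d
    using v that by (auto simp: normalizers_def)
  have vv: "star v * v \<in> D" "v * star v \<in> D" using vd[of 1] by simp_all
  obtain e where e: "e \<in> D" "star e = e" "e * e = e" "e * v * e = 0"
    "\<And>k. k \<in> D \<Longrightarrow> k * e = 0 \<Longrightarrow> k * v * e = 0 \<Longrightarrow> e * v * k = 0 \<Longrightarrow> k * v * k \<in> D"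
    using normalizer_fixed_part[OF masa inj v] by blast
  have "\<sigma> (e * v * e) = \<rho> e * (\<rho> e * \<sigma> v)" using e(1) by (simp add: module)
  moreover have "\<sigma> 0 = 0" using U.state_diff[OF \<sigma>(1), of 0 0] by simp
  ultimately have \<rho>e: "\<rho> e = 0" using nz e(4) by simp
  have e': "1 - e \<in> D" "\<rho> (1 - e) = 1" using e(1) \<rho>e by (auto simp: state_diff[OF st] state_one[OF st])
  have nz1: "\<rho> (star v * v) \<noteq> 0"
  proof
    assume "\<rho> (star v * v) = 0"
    then have "\<sigma> (star v * v) = 0" using \<sigma>(2)[OF vv(1)] by simp
    then have "\<sigma> (star v * 1) = 0" by (rule U.state_star_mult_eq_zero[OF \<sigma>(1) UNIV_I UNIV_I])
    then show False using nz U.state_star[OF \<sigma>(1), of v] by simp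
  qed
  have nz2: "\<rho> (v * star v) \<noteq> 0"
  proof
    assume "\<rho> (v * star v) = 0"
    then have "\<sigma> (star (star v) * star v) = 0" using \<sigma>(2)[OF vv(2)] by (simp add: star_star)
    then have "\<sigma> (star (star v) * 1) = 0"
      by (rule U.state_star_mult_eq_zero[OF \<sigma>(1) UNIV_I UNIV_I])
    then show False using nz by (simp add: star_star)
  qed
  \<comment> \<open>1 - e transported by v and by \<open>star v\<close>:
    \<open>k1 * v * e = 0\<close> and \<open>e * v * k2 = 0\<close>.\<close>
  define k1 k2 where "k1 = v * (1 - e) * star v" and "k2 = star v * (1 - e) * v"
  have k12: "k1 \<in> D" "k2 \<in> D" using vd e' by (auto simp: k1_def k2_def)
  have k1v: "k1 * v = v * ((1 - e) * (star v * v))" by (simp add: k1_def mult.assoc)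
  have vk2: "v * k2 = ((1 - e) * (v * star v)) * v"
    using commute[OF e'(1) vv(2)] by (simp add: k2_def flip: mult.assoc)
  \<comment> \<open>Two evaluations of \<sigma> at k1 v, the second using \<rho> (1 - e) =
    1.\<close>
  have "\<rho> k1 * \<sigma> v = \<rho> (star v * v) * \<sigma> v"
    using module(1)[OF k12(1), of v] e' vv unfolding k1v
    by (auto simp: module(2) mult_mem pure_state_mult[OF \<rho>])
  then have "\<rho> k1 \<noteq> 0" using nz nz1 by auto
  have "\<rho> k2 * \<sigma> v = \<rho> (v * star v) * \<sigma> v"
    using module(2)[OF k12(2), of v] e' vv unfolding vk2
    by (auto simp: module(1) mult_mem pure_state_mult[OF \<rho>])
  then have "\<rho> k2 \<noteq> 0" using nz nz2 by auto
  define k where "k = (1 - e) * (k1 * k2)"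
  have kD: "k \<in> D" using e' k12 by (auto simp: k_def)
  have e1: "(1 - e) * e = 0" "e * (1 - e) = 0" using e(3) by (simp_all add: algebra_simps)
  have comm: "k1 * k2 = k2 * k1" "k = (k1 * k2) * (1 - e)"
    using commute k12 e' by (auto simp: k_def)
  have "k * e = 0" unfolding comm(2) using e1 by (simp add: mult.assoc)
  moreover have "k * v * e = 0"
  proof -
    have "k1 * v * e = v * ((1 - e) * ((star v * v) * e))" unfolding k1v by (simp add: mult.assoc)
    also have "(star v * v) * e = e * (star v * v)" using vv(1) e(1) by (rule commute)
    also have "(1 - e) * (e * (star v * v)) = 0" using e1(1) by (simp flip: mult.assoc)
    finally have "k1 * v * e = 0" by simp
    then show ?thesis unfolding k_def comm(1) by (simp add: mult.assoc)
  qed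
  moreover have "e * v * k = 0"
  proof -
    have "e * v * k2 = e * (1 - e) * (v * star v) * v" using vk2 by (simp add: mult.assoc)
    then have "e * v * k2 = 0" using e1 by simp
    moreover have "k = k2 * (k1 * (1 - e))" unfolding comm(2) comm(1) by (simp add: mult.assoc)
    then have "e * v * k = e * v * k2 * (k1 * (1 - e))" by (simp add: mult.assoc)
    ultimately show ?thesis by simp
  qed
  ultimately have "k * v * k \<in> D" using kD by (intro e(5))
  moreover have "\<rho> k \<noteq> 0"
    using \<open>\<rho> k1 \<noteq> 0\<close> \<open>\<rho> k2 \<noteq> 0\<close> e' k12 by (simp add: k_def pure_state_mult[OF \<rho>] mult_mem)
  ultimately show ?thesis using that kD by blast
qed

lemma state_extension_unique:
  fixes D :: "'a::cstar_algebra set"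
  assumes reg: "regular_masa_inclusion D" and inj: "injective_abelian D" and \<rho>: "pure_state_on D \<rho>"
    and \<sigma>: "state_on UNIV \<sigma>" "\<And>d. d \<in> D \<Longrightarrow> \<sigma> d = \<rho> d"
    and \<tau>: "state_on UNIV \<tau>" "\<And>d. d \<in> D \<Longrightarrow> \<tau> d = \<rho> d"
  shows "\<sigma> = \<tau>"
proof -
  have masa: "masa_inclusion D" and dense: "closure (complex_vector.span (normalizers D)) = UNIV"
    using reg by (simp_all add: regular_masa_inclusion_def regular_inclusion_def)
  interpret abelian_subalgebra D
    using masa by (simp add: masa_inclusion_def inclusion_iff)
  interpret U: unital_subalgebra "UNIV :: 'a set" by (rule unital_subalgebra_UNIV)
  have eq: "\<sigma> v = \<tau> v" if "v \<in> normalizers D" "k \<in> D" "\<rho> k \<noteq> 0" "k * v * k \<in> D" for v k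
  proof -
    have "\<sigma> (k * v * k) = \<tau> (k * v * k)" using that \<sigma>(2) \<tau>(2) by simp
    then show ?thesis
      using that(2,3) by (simp add: state_extension_module[OF \<rho> \<sigma>] state_extension_module[OF \<rho> \<tau>])
  qed
  \<comment> \<open>A k obtained from either extension determines the values of both at v.\<close>
  have norm: "\<sigma> v = \<tau> v" if v: "v \<in> normalizers D" for v
  proof (cases "\<sigma> v = 0 \<and> \<tau> v = 0")
    case False
    then show ?thesis
      using state_extension_value_on_normalizer[OF masa inj v \<rho> \<sigma>]
        state_extension_value_on_normalizer[OF masa inj v \<rho> \<tau>] eq[OF v] by metis
  qed simp
  have span: "\<sigma> y = \<tau> y" if "y \<in> complex_vector.span (normalizers D)" for y
    using that
  proof (induction rule: complex_vector.span_induct_alt)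
    case base
    show ?case using \<sigma>(2)[OF zero_mem] \<tau>(2)[OF zero_mem] by simp
  next
    case (step c x y)
    then show ?case
      by (simp add: U.state_add[OF \<sigma>(1)] U.state_add[OF \<tau>(1)] U.state_scaleC[OF \<sigma>(1)]
          U.state_scaleC[OF \<tau>(1)] norm)
  qed
  have "\<sigma> x = \<tau> x" for x
  proof -
    have "cmod (\<sigma> x - \<tau> x) \<le> 0 + e" if e: "0 < e" for e
    proof -
      have "x \<in> closure (complex_vector.span (normalizers D))" "0 < e / 4" using dense e by simp_all
      then obtain y where y: "y \<in> complex_vector.span (normalizers D)" "dist y x < e / 4"
        unfolding closure_approachable by blast
      have "\<sigma> x - \<tau> x = \<sigma> (x - y) - \<tau> (x - y)"
        using span[OF y(1)] by (simp add: U.state_diff[OF \<sigma>(1)] U.state_diff[OF \<tau>(1)])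
      then have "cmod (\<sigma> x - \<tau> x) \<le> 2 * norm (x - y) + 2 * norm (x - y)"
        using U.state_norm_le[OF \<sigma>(1), of "x - y"] U.state_norm_le[OF \<tau>(1), of "x - y"]
          norm_triangle_ineq4[of "\<sigma> (x - y)" "\<tau> (x - y)"] by simp
      then show ?thesis using y(2) by (simp add: dist_norm norm_minus_commute)
    qed
    then have "cmod (\<sigma> x - \<tau> x) \<le> 0" by (rule field_le_epsilon)
    then show ?thesis by simp
  qed
  then show ?thesis by (rule ext)
qed

theorem theorem2p10:
  fixes D :: "'a::cstar_algebra set"
  assumes "regular_masa_inclusion D"
    and "injective_abelian D"
  shows "extension_property D"
proof -
  interpret abelian_subalgebra D
    using assms(1) by (simp add: regular_masa_inclusion_def masa_inclusion_def inclusion_iff)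
  obtain E where "conditional_expectation E" using expectation_exists[OF assms(2)] by blast
  then have E: "\<And>x. E x \<in> D" "\<And>x y. E (x + y) = E x + E y" "\<And>c x. E (c *\<^sub>C x) = c *\<^sub>C E x"
    "\<And>x. \<exists>y\<in>D. E (star x * x) = star y * y" "\<And>d. d \<in> D \<Longrightarrow> E d = d"
    unfolding conditional_expectation_def by blast+
  have "\<exists>!\<sigma>. state_on UNIV \<sigma> \<and> (\<forall>d\<in>D. \<sigma> d = \<rho> d)" if \<rho>: "pure_state_on D \<rho>" for \<rho>
  proof (rule ex1I[of _ "\<lambda>x. \<rho> (E x)"])
    have st: "state_on D \<rho>" using \<rho> by (simp add: pure_state_on_def)
    have "\<rho> (E (star x * x)) \<in> \<real>\<^sub>\<ge>\<^sub>0" for x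
      using E(4)[of x] state_star_mult[OF st] by auto
    then have ext: "state_on UNIV (\<lambda>x. \<rho> (E x))"
      using E by (simp add: state_on_def state_add[OF st] state_scaleC[OF st] state_one[OF st])
    then show "state_on UNIV (\<lambda>x. \<rho> (E x)) \<and> (\<forall>d\<in>D. \<rho> (E d) = \<rho> d)" using E by simp
    show "\<sigma> = (\<lambda>x. \<rho> (E x))" if "state_on UNIV \<sigma> \<and> (\<forall>d\<in>D. \<sigma> d = \<rho> d)" for \<sigma>
      using state_extension_unique[OF assms \<rho>, of \<sigma> "\<lambda>x. \<rho> (E x)"] that ext E by simp
  qed
  moreover have "\<sigma> 1 \<noteq> 0" if "pure_state_on UNIV \<sigma>" for \<sigma> :: "'a \<Rightarrow> complex"
    using that by (simp add: pure_state_on_def state_on_def)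
  ultimately show ?thesis unfolding extension_property_def by blast
qed

end
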